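(* Let $\{\mathcal{F}_i\}_{i=1}^m$ be a family of hypergraphs on a finite ground set $V$ (each $\mathcal{F}_i\subset 2^V$). If $$w^*\Big(\bigcup_{i\in I}\mathcal{F}_i\Big)>|I|-1\qquad\text{for all }\emptyset\ne I\subset\{1,\dots,m\},$$ then $\{\mathcal{F}_i\}_{i=1}^m$ has a system of disjoint representatives.
   Context: For a hypergraph $\mathcal{F}\subset2^V$ on a finite set $V$, the fractional width $w^*(\mathcal{F})$ is the minimum of $\sum_{E\in\mathcal{F}}f(E)$ over all non-negative functions $f:\mathcal{F}\to\mathbb{R}$ such that for every edge $E\in\mathcal{F}$ one has $\sum_{F\in\mathcal{F}}f(F)\,|E\cap F|\ge1$ (with $w^*(\mathcal{F})=\infty$ if no such $f$ exists). A system of disjoint representatives (SDR) of $\{\mathcal{F}_i\}_{i=1}^m$ is a choice of edges $F_1,\dots,F_m$ with $F_i\in\mathcal{F}_i$ for $1\le i\le m$ and $F_i\cap F_j=\emptyset$ for all $i\ne j$. *)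

theory Defs
  imports
    "HOL-Library.Extended_Real"
    "HOL-Library.Disjoint_Sets"
begin

text \<open>
  A hypergraph on a finite set \<open>V\<close> is a set of edges \<open>F \<subseteq> Pow V\<close>; the empty set is allowed as an edge.
  A weight function is total on \<open>'a set\<close>, but only its values on the edges of \<open>F\<close> are used.
\<close>

definition fractionally_dominating :: "'a set set \<Rightarrow> ('a set \<Rightarrow> real) \<Rightarrow> bool" where
  "fractionally_dominating F f \<longleftrightarrow>
     (\<forall>E\<in>F. f E \<ge> 0) \<and>
     (\<forall>E\<in>F. (\<Sum>G\<in>F. f G * real (card (E \<inter> G))) \<ge> 1)"

text \<open>
  For finite \<open>F\<close> this is the value of a linear program in finitely many variables whose objective is
  bounded below by 0, so the infimum is a minimum whenever a feasible \<open>f\<close> exists. If none exists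
  (exactly when \<open>{} \<in> F\<close>, for finite edges), it is the infimum of the empty set, \<open>\<infinity>\<close>.
  Only finite \<open>F\<close> with finite edges are meaningful, since \<open>sum\<close> and \<open>card\<close> vanish on infinite sets.
\<close>

definition fractional_width :: "'a set set \<Rightarrow> ereal" where
  "fractional_width F = (INF f\<in>{f. fractionally_dominating F f}. ereal (\<Sum>E\<in>F. f E))"

definition is_SDR :: "nat \<Rightarrow> (nat \<Rightarrow> 'a set set) \<Rightarrow> (nat \<Rightarrow> 'a set) \<Rightarrow> bool" where
  "is_SDR m F R \<longleftrightarrow> (\<forall>i\<in>{1..m}. R i \<in> F i) \<and> disjoint_family_on R {1..m}"

end

theory Submission imports Defs begin

text \<open>
  The proof is a topological Hall theorem whose connectivity hypothesis is checked by a spectral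
  argument.

  Take as vertices the pairs of an index \<open>i\<close> and an edge of \<open>F i\<close>, coloured by \<open>i\<close>, and as faces the
  sets of vertices whose edges are pairwise disjoint. A system of disjoint representatives is a
  rainbow face, one that contains each colour exactly once. An index with the empty edge is
  represented by that edge and can be set aside, so all edges are taken to be nonempty.

  Suppose that for each nonempty set \<open>I\<close> of colours, every real cycle of faces with \<open>card I - 1\<close>
  vertices in these colours bounds a chain of faces with \<open>card I\<close> vertices in these colours. Then chains
  \<open>c I\<close> can be built by induction so that the boundary of \<open>c I\<close> is the alternating sum of the \<open>c (I - {i})\<close>:
  they are the images of the faces of a simplex on the colours. Forgetting everything but colours maps
  \<open>c I\<close> back to the simplex \<open>I\<close> with coefficient 1, and a nonzero coefficient needs a rainbow face
  (\<open>homological_Hall\<close>).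

  The width enters through linear programming duality. A fractional width above \<open>K = card I - 1\<close> gives
  positive vertex weights \<open>g\<close> such that, for every vertex \<open>u\<close>, the sum of \<open>g w * overlap S u w\<close> over
  all \<open>w\<close> is less than the total weight divided by \<open>K\<close> (\<open>wide_imp_weights\<close>, in a form free of division).
  With these weights a harmonic chain on faces with \<open>K\<close> vertices is zero (\<open>harmonic_vanishes\<close>). Indeed
  the weighted energy of a chain consists of a nonnegative diagonal part and a quadratic form over
  pairs of intersecting edges; the matrix of intersection sizes is a Gram matrix, hence positive
  semidefinite, and comparison with it leaves a diagonal form whose coefficients are positive exactly
  because of the inequality for \<open>g\<close>. By orthogonal projection, a cycle differs from some boundary by a
  harmonic chain, so every cycle is a boundary (\<open>cycle_is_boundary\<close>).
\<close>

section \<open>Linear inequalities and orthogonal projection\<close>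

text \<open>
  Induction on the number of constraints, for all \<open>a\<close> and \<open>b\<close> at once. Either the new constraint is redundant,
  or some \<open>y\<close> satisfies the old constraints and violates both the new one and the conclusion. Projecting
  along \<open>y\<close> onto the kernel of the new functional removes that functional from the system, and \<open>y\<close>
  itself shows that its multiplier is nonnegative.
\<close>

lemma farkas:
  fixes a :: "'i \<Rightarrow> 'c \<Rightarrow> real" and b :: "'c \<Rightarrow> real"
  assumes "finite T" and C: "finite C"
    and "\<And>x. (\<forall>i\<in>T. (\<Sum>c\<in>C. a i c * x c) \<le> 0) \<Longrightarrow> (\<Sum>c\<in>C. b c * x c) \<le> 0"
  shows "\<exists>l. (\<forall>i\<in>T. l i \<ge> 0) \<and> (\<forall>c\<in>C. b c = (\<Sum>i\<in>T. l i * a i c))"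
  using assms(1,3)
proof (induction T arbitrary: a b rule: finite_induct)
  case empty
  have "(\<Sum>c\<in>C. b c * b c) \<le> 0" by (rule empty) simp
  moreover have "(\<Sum>c\<in>C. b c * b c) \<ge> 0" by (intro sum_nonneg) simp
  ultimately have "(\<Sum>c\<in>C. b c * b c) = 0" by linarith
  then have "\<forall>c\<in>C. b c = 0" using C by (subst (asm) sum_nonneg_eq_0_iff) auto
  then show ?case by simp
next
  case (insert t T)
  let ?d = "\<lambda>p x. \<Sum>c\<in>C. p c * (x c :: real)"
  show ?case
  proof (cases "\<forall>x. (\<forall>i\<in>T. ?d (a i) x \<le> 0) \<longrightarrow> ?d b x \<le> 0")
    case True
    then obtain l where l: "\<forall>i\<in>T. l i \<ge> 0" "\<forall>c\<in>C. b c = (\<Sum>i\<in>T. l i * a i c)"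
      using insert.IH[of a b] by blast
    have "(\<Sum>i\<in>insert t T. (l(t:=0)) i * a i c) = (\<Sum>i\<in>T. l i * a i c)" for c
      using insert.hyps by (auto intro!: sum.cong)
    then show ?thesis using l insert.hyps by (intro exI[of _ "l(t:=0)"]) auto
  next
    case False
    then obtain y where y: "\<And>i. i \<in> T \<Longrightarrow> ?d (a i) y \<le> 0" "?d b y > 0" by (auto simp: not_le)
    have ty: "?d (a t) y > 0"
    proof (rule ccontr)
      assume "\<not> ?d (a t) y > 0"
      then have "?d b y \<le> 0" using y(1) by (intro insert.prems) auto
      with y(2) show False by simp
    qed
    define s where "s = ?d (a t) y"
    have s: "s > 0" using ty s_def by simp
    define a' where "a' = (\<lambda>i c. a i c - (?d (a i) y / s) * a t c)"
    define b' where "b' = (\<lambda>c. b c - (?d b y / s) * a t c)"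
    \<comment> \<open>Evaluating a reduced functional at x amounts to evaluating the original one at the projection
        of x along y to the kernel of \<open>a t\<close>.\<close>
    have proj: "?d (\<lambda>c. p c - (?d p y / s) * a t c) x = ?d p (\<lambda>c. x c - (?d (a t) x / s) * y c)" for p x
    proof -
      have e1: "?d (\<lambda>c. p c - k * a t c) x = ?d p x - k * ?d (a t) x" for k
        by (simp add: algebra_simps sum_subtractf sum_distrib_left)
      have e2: "?d p (\<lambda>c. x c - k * y c) = ?d p x - k * ?d p y" for k
        by (simp add: algebra_simps sum_subtractf sum_distrib_left)
      show ?thesis unfolding e1 e2 by simp
    qed
    have "?d b' x \<le> 0" if x: "\<forall>i\<in>T. ?d (a' i) x \<le> 0" for x
    proof -
      let ?x = "\<lambda>c. x c - (?d (a t) x / s) * y c"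
      have "?d (a t) ?x = ?d (\<lambda>c. a t c - (?d (a t) y / s) * a t c) x" by (simp only: proj)
      also have "\<dots> = 0" using s by (simp add: s_def[symmetric])
      finally have "?d (a t) ?x = 0" .
      moreover have "?d (a i) ?x \<le> 0" if "i \<in> T" for i
        using bspec[OF x that] unfolding a'_def proj .
      ultimately have "?d b ?x \<le> 0" by (intro insert.prems) auto
      then show ?thesis unfolding b'_def proj .
    qed
    then obtain l where l: "\<forall>i\<in>T. l i \<ge> 0" "\<forall>c\<in>C. b' c = (\<Sum>i\<in>T. l i * a' i c)"
      using insert.IH[of a' b'] by blast
    define k where "k = ?d b y / s - (\<Sum>i\<in>T. l i * (?d (a i) y / s))"
    have "(\<Sum>i\<in>T. l i * (?d (a i) y / s)) \<le> 0"
      using l(1) y(1) s by (intro sum_nonpos mult_nonneg_nonpos) (auto simp: divide_nonpos_pos)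
    moreover have "?d b y / s > 0" using y(2) s by simp
    ultimately have "k \<ge> 0" unfolding k_def by linarith
    have "b c = (\<Sum>i\<in>insert t T. (l(t:=k)) i * a i c)" if "c \<in> C" for c
    proof -
      have "b c = b' c + (?d b y / s) * a t c" by (simp add: b'_def)
      also have "b' c = (\<Sum>i\<in>T. l i * a' i c)" using l(2) that by blast
      also have "\<dots> = (\<Sum>i\<in>T. l i * a i c) - (\<Sum>i\<in>T. l i * (?d (a i) y / s)) * a t c"
        by (simp only: a'_def right_diff_distrib sum_subtractf sum_distrib_right mult.assoc)
      finally have "b c = (\<Sum>i\<in>T. l i * a i c) + k * a t c"
        by (simp add: k_def left_diff_distrib)
      moreover have "(\<Sum>i\<in>T. (l(t:=k)) i * a i c) = (\<Sum>i\<in>T. l i * a i c)"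
        using insert.hyps by (intro sum.cong) auto
      ultimately show ?thesis using insert.hyps by simp
    qed
    then show ?thesis using \<open>k \<ge> 0\<close> l(1) insert.hyps(2) by (intro exI[of _ "l(t:=k)"]) auto
  qed
qed

text \<open>
  Duality for strict inequalities: a nonzero nonnegative combination of rows without negative entries is
  the only obstruction to \<open>M g < 0\<close> with all entries of \<open>g\<close> positive. Strict positivity of the solution
  makes \<open>g\<close> usable as a weight for an inner product.
\<close>

lemma strict_positive_alternative:
  fixes M :: "'u \<Rightarrow> 'w \<Rightarrow> real"
  assumes U: "finite U" and W: "finite W"
    and no: "\<And>f. \<lbrakk>\<forall>u\<in>U. f u \<ge> 0; (\<Sum>u\<in>U. f u) = 1; \<forall>w\<in>W. (\<Sum>u\<in>U. f u * M u w) \<ge> 0\<rbrakk> \<Longrightarrow> False"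
  shows "\<exists>g. (\<forall>w\<in>W. g w > 0) \<and> (\<forall>u\<in>U. (\<Sum>w\<in>W. M u w * g w) < 0)"
proof (rule ccontr)
  assume nog: "\<not> ?thesis"
  \<comment> \<open>The extra coordinate None is a common margin for all strict inequalities; the assumption says
      that the margin cannot be positive.\<close>
  define C where "C = insert None (Some ` W)"
  define T where "T = U <+> W"
  define a where "a = (\<lambda>i c. case i of
      Inl u \<Rightarrow> (case c of None \<Rightarrow> 1 | Some w \<Rightarrow> M u w)
    | Inr v \<Rightarrow> (case c of None \<Rightarrow> 1 | Some w \<Rightarrow> if w = v then -1 else (0::real)))"
  define b where "b = (\<lambda>c :: 'w option. case c of None \<Rightarrow> 1 | Some w \<Rightarrow> (0::real))"
  have sC: "(\<Sum>c\<in>C. p c) = p None + (\<Sum>w\<in>W. p (Some w))" for p :: "'w option \<Rightarrow> real"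
    using W by (simp add: C_def sum.reindex)
  have sT: "(\<Sum>i\<in>T. p i) = (\<Sum>u\<in>U. p (Inl u)) + (\<Sum>w\<in>W. p (Inr w))" for p :: "'u + 'w \<Rightarrow> real"
    using U W by (simp add: T_def sum.Plus)
  have delta: "(\<Sum>w\<in>W. (if w = v then -1 else 0) * x w) = - x v" if "v \<in> W" for v and x :: "'w \<Rightarrow> real"
    using W that by (simp add: if_distrib[of "\<lambda>t. t * _"] cong: if_cong)
  have delta': "(\<Sum>v\<in>W. x v * (if w = v then -1 else 0)) = - x w" if "w \<in> W" for w and x :: "'w \<Rightarrow> real"
    using W that by (simp add: if_distrib[of "\<lambda>t. _ * t"] cong: if_cong)
  have imp: "(\<Sum>c\<in>C. b c * x c) \<le> 0" if x: "\<forall>i\<in>T. (\<Sum>c\<in>C. a i c * x c) \<le> 0" for x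
  proof (rule ccontr)
    assume "\<not> (\<Sum>c\<in>C. b c * x c) \<le> 0"
    then have pos: "x None > 0" by (simp add: sC b_def)
    have "x (Some v) > 0" if "v \<in> W" for v
    proof -
      have "(\<Sum>c\<in>C. a (Inr v) c * x c) \<le> 0" using x that by (auto simp: T_def)
      then show ?thesis using pos that by (simp add: sC a_def delta)
    qed
    moreover have "(\<Sum>w\<in>W. M u w * x (Some w)) < 0" if "u \<in> U" for u
    proof -
      have "(\<Sum>c\<in>C. a (Inl u) c * x c) \<le> 0" using x that by (auto simp: T_def)
      then show ?thesis using pos by (simp add: sC a_def)
    qed
    ultimately show False using nog by (auto dest!: spec[of _ "\<lambda>w. x (Some w)"])
  qed
  have "finite T" "finite C" using U W by (auto simp: T_def C_def)
  from farkas[OF this imp] obtain l where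
    l: "\<forall>i\<in>T. l i \<ge> 0" "\<forall>c\<in>C. b c = (\<Sum>i\<in>T. l i * a i c)" by blast
  have fn: "\<forall>u\<in>U. l (Inl u) \<ge> 0" and mn: "\<forall>w\<in>W. l (Inr w) \<ge> 0" using l(1) by (auto simp: T_def)
  have one: "1 = (\<Sum>u\<in>U. l (Inl u)) + (\<Sum>w\<in>W. l (Inr w))"
    using l(2)[rule_format, of None] by (simp add: C_def sT a_def b_def)
  have col: "(\<Sum>u\<in>U. l (Inl u) * M u w) = l (Inr w)" if "w \<in> W" for w
  proof -
    have "0 = (\<Sum>u\<in>U. l (Inl u) * M u w) + (\<Sum>v\<in>W. l (Inr v) * (if w = v then -1 else 0))"
      using l(2)[rule_format, of "Some w"] that by (simp add: C_def sT a_def b_def)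
    then show ?thesis using delta'[OF that, of "\<lambda>v. l (Inr v)"] by simp
  qed
  define t where "t = (\<Sum>u\<in>U. l (Inl u))"
  have "t \<noteq> 0"
  proof
    assume "t = 0"
    then have "\<forall>u\<in>U. l (Inl u) = 0" using fn U by (simp add: t_def sum_nonneg_eq_0_iff)
    then have "\<forall>w\<in>W. l (Inr w) = 0" using col by force
    with \<open>t = 0\<close> one show False by (simp add: t_def)
  qed
  then have t: "t > 0" using fn by (simp add: t_def sum_nonneg less_le)
  show False
  proof (rule no[of "\<lambda>u. l (Inl u) / t"])
    show "\<forall>u\<in>U. l (Inl u) / t \<ge> 0" using fn t by simp
    show "(\<Sum>u\<in>U. l (Inl u) / t) = 1" using t by (simp add: sum_divide_distrib[symmetric] t_def[symmetric])
    have "(\<Sum>u\<in>U. l (Inl u) / t * M u w) = l (Inr w) / t" if "w \<in> W" for w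
      using col[OF that] by (simp add: sum_divide_distrib[symmetric])
    then show "\<forall>w\<in>W. (\<Sum>u\<in>U. l (Inl u) / t * M u w) \<ge> 0" using mn t by simp
  qed
qed

text \<open>
  Projection of \<open>z\<close> onto the span of the \<open>b s\<close>, by Gram-Schmidt: the part of a new vector that is
  orthogonal to the old span is subtracted with the right coefficient. If that part vanishes, any
  coefficient serves, and division by 0 supplies one.
\<close>

lemma orthogonal_decomposition:
  fixes h :: "'d \<Rightarrow> real" and b :: "'t \<Rightarrow> 'd \<Rightarrow> real"
  assumes "finite T" and D: "finite D" and h: "\<And>d. d \<in> D \<Longrightarrow> h d > 0"
  shows "\<exists>y. \<forall>t\<in>T. (\<Sum>d\<in>D. h d * (z d - (\<Sum>s\<in>T. y s * b s d)) * b t d) = 0"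
  using assms(1)
proof (induction T arbitrary: z rule: finite_induct)
  case empty
  then show ?case by simp
next
  case (insert t T)
  let ?ip = "\<lambda>p q. \<Sum>d\<in>D. h d * p d * (q d :: real)"
  obtain y1 where y1: "\<forall>s\<in>T. ?ip (\<lambda>d. z d - (\<Sum>s\<in>T. y1 s * b s d)) (b s) = 0"
    using insert.IH[of z] by blast
  obtain y2 where y2: "\<forall>s\<in>T. ?ip (\<lambda>d. b t d - (\<Sum>s\<in>T. y2 s * b s d)) (b s) = 0"
    using insert.IH[of "b t"] by blast
  define r where "r = (\<lambda>d. z d - (\<Sum>s\<in>T. y1 s * b s d))"
  define q where "q = (\<lambda>d. b t d - (\<Sum>s\<in>T. y2 s * b s d))"
  have r: "?ip r (b s) = 0" and q: "?ip q (b s) = 0" if "s \<in> T" for s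
    using y1 y2 that by (auto simp: r_def q_def)
  have comb: "?ip p (\<lambda>d. \<Sum>s\<in>T. y2 s * b s d) = (\<Sum>s\<in>T. y2 s * ?ip p (b s))" for p
    by (simp only: sum_distrib_left, subst sum.swap) (simp add: mult_ac)
  have bt: "b t d = q d + (\<Sum>s\<in>T. y2 s * b s d)" for d by (simp add: q_def)
  have ipt: "?ip p (b t) = ?ip p q + (\<Sum>s\<in>T. y2 s * ?ip p (b s))" for p
    unfolding bt comb[symmetric] by (simp add: distrib_left sum.distrib)
  define k where "k = ?ip r q / ?ip q q"
  define y where "y = (\<lambda>s. if s = t then k else y1 s - k * y2 s)"
  have res: "z d - (\<Sum>s\<in>insert t T. y s * b s d) = r d - k * q d" for d
  proof -
    have "(\<Sum>s\<in>T. y s * b s d) = (\<Sum>s\<in>T. (y1 s - k * y2 s) * b s d)"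
      using insert.hyps(2) by (intro sum.cong) (auto simp: y_def)
    also have "\<dots> = (\<Sum>s\<in>T. y1 s * b s d) - k * (\<Sum>s\<in>T. y2 s * b s d)"
      by (simp add: algebra_simps sum_subtractf sum_distrib_left)
    finally show ?thesis using insert.hyps by (simp add: y_def r_def q_def algebra_simps)
  qed
  have lin: "?ip (\<lambda>d. r d - k * q d) p = ?ip r p - k * ?ip q p" for p
    by (simp add: algebra_simps sum_subtractf sum_distrib_left)
  have "?ip r q - k * ?ip q q = 0"
  proof (cases "?ip q q = 0")
    case True
    then have "\<forall>d\<in>D. h d * q d * q d = 0"
      using D h by (subst (asm) sum_nonneg_eq_0_iff) (auto simp: mult.assoc less_imp_le)
    then have "\<forall>d\<in>D. q d = 0" using h by force
    then show ?thesis using True by simp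
  qed (simp add: k_def)
  then have "?ip (\<lambda>d. r d - k * q d) (b t) = 0"
    using r q by (simp add: lin ipt)
  moreover have "?ip (\<lambda>d. r d - k * q d) (b s) = 0" if "s \<in> T" for s
    using r[OF that] q[OF that] by (simp add: lin)
  ultimately show ?case unfolding res[symmetric] by blast
qed

section \<open>Chains on finite sets of ordered vertices\<close>

text \<open>
  The sign that moves \<open>u\<close> from the front of \<open>\<rho>\<close> to its place in increasing order. With it a chain is a plain
  function on vertex sets, without a choice of orientation.
\<close>

definition insertion_sign :: "'v::linorder \<Rightarrow> 'v set \<Rightarrow> real" where
  "insertion_sign u \<rho> = (-1) ^ card {v\<in>\<rho>. v < u}"

lemma insertion_sign_square [simp]: "insertion_sign u \<rho> * insertion_sign u \<rho> = 1"
  by (simp add: insertion_sign_def flip: power_mult_distrib)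

lemma insertion_sign_insert:
  assumes "finite \<rho>" "w \<notin> \<rho>"
  shows "insertion_sign u (insert w \<rho>) = (if w < u then - insertion_sign u \<rho> else insertion_sign u \<rho>)"
proof -
  have "{v \<in> insert w \<rho>. v < u} = (if w < u then insert w {v \<in> \<rho>. v < u} else {v \<in> \<rho>. v < u})" by auto
  then show ?thesis using assms by (simp add: insertion_sign_def)
qed

text \<open>
  Signs relative to \<open>insert w \<rho>\<close> and \<open>insert u \<rho>\<close> occur in the coboundary, signs relative to \<open>\<rho>\<close> in the
  boundary. The minus sign between them lets the two conditions on a harmonic chain cancel on
  disjoint pairs.
\<close>

lemma insertion_sign_exchange:
  assumes "finite \<rho>" "u \<notin> \<rho>" "w \<notin> \<rho>" "u \<noteq> w"
  shows "insertion_sign u (insert w \<rho>) * insertion_sign w (insert u \<rho>) = - (insertion_sign u \<rho> * insertion_sign w \<rho>)"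
  using assms by (auto simp: insertion_sign_insert)

lemma insertion_sign_antisym:
  assumes "finite \<rho>" "u \<notin> \<rho>" "w \<notin> \<rho>" "u \<noteq> w"
  shows "insertion_sign u \<rho> * insertion_sign w (insert u \<rho>) = - (insertion_sign w \<rho> * insertion_sign u (insert w \<rho>))"
  using assms by (auto simp: insertion_sign_insert)

text \<open>
  The boundary operator of the full simplex on \<open>N\<close>, read off at a face: the coefficient of \<open>\<rho>\<close> collects all
  simplices with one more vertex. On a chain supported in a subcomplex it is the boundary
  operator of that subcomplex.
\<close>

definition boundary :: "'v::linorder set \<Rightarrow> ('v set \<Rightarrow> real) \<Rightarrow> 'v set \<Rightarrow> real" where
  "boundary N x \<rho> = (\<Sum>u\<in>N - \<rho>. insertion_sign u \<rho> * x (insert u \<rho>))"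

lemma antisym_sum_0:
  fixes h :: "'v \<Rightarrow> 'v \<Rightarrow> real"
  assumes "finite A" and h: "\<And>u w. \<lbrakk>u \<in> A; w \<in> A; u \<noteq> w\<rbrakk> \<Longrightarrow> h u w = - h w u"
  shows "(\<Sum>u\<in>A. \<Sum>w\<in>A - {u}. h u w) = 0"
proof -
  define k where "k = (\<lambda>u w. if u = w then 0 else h u w)"
  have "(\<Sum>w\<in>A - {u}. h u w) = (\<Sum>w\<in>A. k u w)" if "u \<in> A" for u
  proof -
    have "(\<Sum>w\<in>A. k u w) = k u u + (\<Sum>w\<in>A - {u}. k u w)" using assms(1) that by (rule sum.remove)
    also have "(\<Sum>w\<in>A - {u}. k u w) = (\<Sum>w\<in>A - {u}. h u w)" by (rule sum.cong) (auto simp: k_def)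
    finally show ?thesis by (simp add: k_def)
  qed
  then have eq: "(\<Sum>u\<in>A. \<Sum>w\<in>A - {u}. h u w) = (\<Sum>u\<in>A. \<Sum>w\<in>A. k u w)" by (rule sum.cong[OF refl])
  have anti: "k u w = - k w u" if "u \<in> A" "w \<in> A" for u w
    using h[OF that] by (auto simp: k_def)
  have "(\<Sum>u\<in>A. \<Sum>w\<in>A. k u w) = (\<Sum>u\<in>A. \<Sum>w\<in>A. - k w u)"
    by (intro sum.cong refl anti)
  also have "\<dots> = - (\<Sum>u\<in>A. \<Sum>w\<in>A. k w u)" by (simp only: sum_negf)
  also have "(\<Sum>u\<in>A. \<Sum>w\<in>A. k w u) = (\<Sum>u\<in>A. \<Sum>w\<in>A. k u w)" by (rule sum.swap)
  finally show ?thesis unfolding eq by linarith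
qed

lemma boundary_boundary:
  assumes "finite N" "finite \<rho>"
  shows "boundary N (boundary N y) \<rho> = 0"
proof -
  have "N - insert u \<rho> = (N - \<rho>) - {u}" for u by auto
  then have "boundary N (boundary N y) \<rho> =
      (\<Sum>u\<in>N - \<rho>. \<Sum>w\<in>(N - \<rho>) - {u}. insertion_sign u \<rho> * insertion_sign w (insert u \<rho>) * y (insert w (insert u \<rho>)))"
    by (simp only: boundary_def sum_distrib_left mult.assoc)
  also have "\<dots> = 0"
  proof (rule antisym_sum_0)
    fix u w assume "u \<in> N - \<rho>" "w \<in> N - \<rho>" "u \<noteq> w"
    then have "insertion_sign u \<rho> * insertion_sign w (insert u \<rho>) = - (insertion_sign w \<rho> * insertion_sign u (insert w \<rho>))"
      using assms by (intro insertion_sign_antisym) auto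
    moreover have "insert w (insert u \<rho>) = insert u (insert w \<rho>)" by auto
    ultimately show "insertion_sign u \<rho> * insertion_sign w (insert u \<rho>) * y (insert w (insert u \<rho>)) =
      - (insertion_sign w \<rho> * insertion_sign u (insert w \<rho>) * y (insert u (insert w \<rho>)))"
      by (simp only: minus_mult_left)
  qed (use assms in auto)
  finally show ?thesis .
qed

section \<open>A homological Hall theorem\<close>

definition rainbow :: "'v set set \<Rightarrow> ('v \<Rightarrow> 'c) \<Rightarrow> 'c set \<Rightarrow> 'v set set" where
  "rainbow X col J = {\<sigma>\<in>X. inj_on col \<sigma> \<and> col ` \<sigma> = J}"

text \<open>
  The simplicial map that sends vertices to colours commutes with the boundary. For a monotone
  colouring no permutation signs arise on rainbow faces. A face with \<open>J\<close> as colours and one repeated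
  colour contributes nothing: its two vertices of equal colour are adjacent in the order, so
  deleting the one or the other gives opposite signs.
\<close>

lemma rainbow_sum_boundary:
  fixes col :: "'v::linorder \<Rightarrow> 'c::linorder"
  assumes N: "finite N" and mono: "mono_on N col"
    and X: "\<And>\<sigma>. \<sigma> \<in> X \<Longrightarrow> \<sigma> \<subseteq> N" and down: "\<And>\<sigma> \<tau>. \<lbrakk>\<sigma> \<in> X; \<tau> \<subseteq> \<sigma>\<rbrakk> \<Longrightarrow> \<tau> \<in> X"
    and i: "i \<notin> J"
    and supp: "\<And>\<sigma>. x \<sigma> \<noteq> 0 \<Longrightarrow> \<sigma> \<in> X \<and> col ` \<sigma> \<subseteq> insert i J"
  shows "(\<Sum>\<rho>\<in>rainbow X col J. boundary N x \<rho>) = insertion_sign i J * (\<Sum>\<sigma>\<in>rainbow X col (insert i J). x \<sigma>)"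
proof -
  have "finite X" using X N by (meson Pow_iff finite_Pow_iff finite_subset subsetI)
  then have fr: "finite (rainbow X col L)" for L by (auto simp: rainbow_def)
  define P where "P = {(\<rho>, u). \<rho> \<in> rainbow X col J \<and> u \<in> N - \<rho>}"
  define Q where "Q = {(\<rho>, u) \<in> P. insert u \<rho> \<in> X}"
  define Q1 where "Q1 = {(\<rho>, u) \<in> Q. col u = i}"
  define Q2 where "Q2 = {(\<rho>, u) \<in> Q. col u \<in> J}"
  let ?f = "\<lambda>(\<rho>, u). insertion_sign u \<rho> * x (insert u \<rho>)"
  have P: "P = Sigma (rainbow X col J) (\<lambda>\<rho>. N - \<rho>)" by (auto simp: P_def)
  have fP: "finite P" unfolding P using fr N by auto
  have fQ: "finite Q1" "finite Q2" using fP by (auto simp: Q1_def Q2_def Q_def intro: finite_subset)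
  have supp': "col u \<in> insert i J \<and> insert u \<rho> \<in> X" if "x (insert u \<rho>) \<noteq> 0" for u \<rho>
    using supp[OF that] by auto
  have "(\<Sum>\<rho>\<in>rainbow X col J. boundary N x \<rho>) = sum ?f P"
    unfolding boundary_def P using fr N by (subst sum.Sigma) auto
  also have "sum ?f P = sum ?f (Q1 \<union> Q2)"
  proof (rule sum.mono_neutral_right[OF fP])
    show "Q1 \<union> Q2 \<subseteq> P" by (auto simp: Q1_def Q2_def Q_def)
    have z: "?f (\<rho>, u) = 0" if "(\<rho>, u) \<in> P - (Q1 \<union> Q2)" for \<rho> u
      using that supp'[of u \<rho>] by (auto simp: Q1_def Q2_def Q_def)
    show "\<forall>p\<in>P - (Q1 \<union> Q2). ?f p = 0"
    proof
      fix p assume "p \<in> P - (Q1 \<union> Q2)"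
      then show "?f p = 0" using z[of "fst p" "snd p"] by simp
    qed
  qed
  also have "\<dots> = sum ?f Q1 + sum ?f Q2"
    using i fQ by (intro sum.union_disjoint) (auto simp: Q1_def Q2_def)
  also have "sum ?f Q1 = (\<Sum>\<sigma>\<in>rainbow X col (insert i J). insertion_sign i J * x \<sigma>)"
  proof (rule sum.reindex_bij_witness[where j = "\<lambda>(\<rho>,u). insert u \<rho>"
        and i = "\<lambda>\<sigma>. (\<sigma> - {inv_into \<sigma> col i}, inv_into \<sigma> col i)"])
    fix p assume "p \<in> Q1"
    then obtain \<rho> u where p: "p = (\<rho>, u)" and \<rho>: "\<rho> \<in> X" "inj_on col \<rho>" "col ` \<rho> = J"
      and u: "u \<in> N" "u \<notin> \<rho>" "insert u \<rho> \<in> X" "col u = i"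
      by (auto simp: Q1_def Q_def P_def rainbow_def)
    have inj: "inj_on col (insert u \<rho>)" using \<rho> u i by auto
    then have inv: "inv_into (insert u \<rho>) col i = u" using u(4) by (metis inv_into_f_f insertI1)
    show "(\<lambda>\<sigma>. (\<sigma> - {inv_into \<sigma> col i}, inv_into \<sigma> col i)) ((\<lambda>(\<rho>,u). insert u \<rho>) p) = p"
      using u(2) by (simp add: p inv)
    show "(\<lambda>(\<rho>,u). insert u \<rho>) p \<in> rainbow X col (insert i J)"
      using inj u \<rho> by (auto simp: p rainbow_def)
    \<comment> \<open>The colouring is monotone and injective on this face, so it preserves the position of u.\<close>
    have "v < u \<longleftrightarrow> col v < i" if "v \<in> \<rho>" for v
    proof -
      have "col v \<in> J" using that \<rho>(3) by blast
      then have "v \<in> N" "col v \<noteq> i" "v \<noteq> u" using that X[OF \<rho>(1)] i u(2) by auto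
      then show ?thesis using mono_onD[OF mono, of u v] mono_onD[OF mono, of v u] u
        by (metis leD le_less linorder_le_less_linear)
    qed
    then have "{j\<in>J. j < i} = col ` {v\<in>\<rho>. v < u}" using \<rho>(3) by auto
    moreover have "inj_on col {v\<in>\<rho>. v < u}" using \<rho>(2) by (rule inj_on_subset) auto
    ultimately have "insertion_sign u \<rho> = insertion_sign i J" by (simp add: insertion_sign_def card_image)
    then show "insertion_sign i J * x ((\<lambda>(\<rho>,u). insert u \<rho>) p) = ?f p" by (simp add: p)
  next
    fix \<sigma> assume "\<sigma> \<in> rainbow X col (insert i J)"
    then have \<sigma>: "\<sigma> \<in> X" "inj_on col \<sigma>" "col ` \<sigma> = insert i J" by (auto simp: rainbow_def)
    define u where "u = inv_into \<sigma> col i"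
    have u: "u \<in> \<sigma>" "col u = i" using \<sigma>(3) by (auto simp: u_def inv_into_into f_inv_into_f)
    show "(\<lambda>(\<rho>,u). insert u \<rho>) (\<sigma> - {inv_into \<sigma> col i}, inv_into \<sigma> col i) = \<sigma>"
      using u(1) by (auto simp: u_def[symmetric])
    have "col ` (\<sigma> - {u}) = J" using inj_on_image_set_diff[OF \<sigma>(2), of \<sigma> "{u}"] u \<sigma>(3) i by auto
    then have "\<sigma> - {u} \<in> rainbow X col J"
      using \<sigma> down[OF \<sigma>(1), of "\<sigma> - {u}"] by (auto simp: rainbow_def intro: inj_on_subset)
    then show "(\<sigma> - {inv_into \<sigma> col i}, inv_into \<sigma> col i) \<in> Q1"
      using u X[OF \<sigma>(1)] \<sigma>(1) by (auto simp: u_def[symmetric] Q1_def Q_def P_def insert_absorb)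
  qed
  also have "sum ?f Q2 = 0"
  proof -
    \<comment> \<open>Exchange of the deleted vertex with its twin, the other vertex of the same colour.\<close>
    define tw where "tw = (\<lambda>(\<rho>, u). inv_into \<rho> col (col u))"
    define sw where "sw = (\<lambda>(\<rho>, u). (insert u (\<rho> - {tw (\<rho>, u)}), tw (\<rho>, u)))"
    have sw: "sw p \<in> Q2 \<and> sw (sw p) = p \<and> - ?f (sw p) = ?f p" if "p \<in> Q2" for p
    proof -
      obtain \<rho> u where p: "p = (\<rho>, u)" and \<rho>: "\<rho> \<in> X" "inj_on col \<rho>" "col ` \<rho> = J"
        and u: "u \<in> N" "u \<notin> \<rho>" "insert u \<rho> \<in> X" "col u \<in> J"
        using \<open>p \<in> Q2\<close> by (auto simp: Q2_def Q_def P_def rainbow_def)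
      define w where "w = tw (\<rho>, u)"
      have w: "w \<in> \<rho>" "col w = col u" using u(4) \<rho>(3)
        by (auto simp: w_def tw_def inv_into_into f_inv_into_f)
      define \<pi> where "\<pi> = \<rho> - {w}"
      have \<rho>\<pi>: "\<rho> = insert w \<pi>" "w \<notin> \<pi>" using w by (auto simp: \<pi>_def)
      have u\<pi>: "u \<notin> \<pi>" "u \<noteq> w" using u(2) w(1) by (auto simp: \<pi>_def)
      have fin: "finite \<pi>" using X[OF \<rho>(1)] N by (auto simp: \<pi>_def intro: finite_subset)
      have eqset: "insert w (insert u \<pi>) = insert u \<rho>" by (auto simp: \<rho>\<pi>)
      have swp: "sw p = (insert u \<pi>, w)" by (simp add: p sw_def w_def \<pi>_def)
      have inj': "inj_on col (insert u \<pi>)" using \<rho>(2) w(2) \<rho>\<pi>(2) u\<pi>(1) by (simp add: \<rho>\<pi>(1))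
      have im: "col ` insert u \<pi> = J" using \<rho>(3) w(2) by (auto simp: \<rho>\<pi>(1))
      have "insert u \<pi> \<in> X" by (rule down[OF u(3)]) (auto simp: \<rho>\<pi>(1))
      then have "insert u \<pi> \<in> rainbow X col J" using inj' im by (simp add: rainbow_def)
      moreover have "w \<in> N - insert u \<pi>" using w(1) X[OF \<rho>(1)] \<rho>\<pi>(2) u\<pi>(2) by auto
      moreover have "insert w (insert u \<pi>) \<in> X" unfolding eqset by (rule u(3))
      moreover have "col w \<in> J" using w(2) u(4) by simp
      ultimately have mem: "sw p \<in> Q2" by (simp add: swp Q2_def Q_def P_def)
      have "tw (insert u \<pi>, w) = inv_into (insert u \<pi>) col (col u)" by (simp only: tw_def case_prod_conv w(2))
      also have "\<dots> = u" by (rule inv_into_f_f[OF inj']) simp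
      finally have "sw (insert u \<pi>, w) = (insert w (insert u \<pi> - {u}), u)" by (simp add: sw_def)
      also have "insert u \<pi> - {u} = \<pi>" using u\<pi>(1) by simp
      finally have inv: "sw (sw p) = p" unfolding swp unfolding p \<rho>\<pi>(1) .
      \<comment> \<open>No vertex of the face lies between u and w, since only these two have their colour.\<close>
      have "v < u \<longleftrightarrow> v < w" if "v \<in> \<pi>" for v
      proof -
        have "col v \<noteq> col u" using inj_onD[OF inj', of v u] that u\<pi>(1) by auto
        then have v: "v \<in> N" "w \<in> N" "u \<in> N" "col v \<noteq> col w" "col v \<noteq> col u" "v \<noteq> u" "v \<noteq> w"
          using that X[OF \<rho>(1)] w u(1) u\<pi>(1) \<rho>\<pi> by auto
        have "v < t \<longleftrightarrow> col v < col t" if "t \<in> N" "col v \<noteq> col t" for t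
          using mono_onD[OF mono, of v t] mono_onD[OF mono, of t v] v(1) that
          by (metis leD le_less linorder_le_less_linear)
        then show ?thesis using v w(2) by simp
      qed
      then have "{v\<in>\<pi>. v < u} = {v\<in>\<pi>. v < w}" by auto
      then have "insertion_sign u \<pi> = insertion_sign w \<pi>" by (simp add: insertion_sign_def)
      then have "insertion_sign w (insert u \<pi>) = - insertion_sign u \<rho>"
        using fin \<rho>\<pi>(2) u\<pi> unfolding \<rho>\<pi>(1) by (auto simp: insertion_sign_insert)
      moreover have "?f (sw p) = insertion_sign w (insert u \<pi>) * x (insert u \<rho>)" by (simp only: swp case_prod_conv eqset)
      moreover have "?f p = insertion_sign u \<rho> * x (insert u \<rho>)" by (simp only: p case_prod_conv)
      ultimately have "- ?f (sw p) = ?f p" by simp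
      with mem inv show ?thesis by blast
    qed
    have "sum ?f Q2 = (\<Sum>p\<in>Q2. - ?f p)"
      by (rule sum.reindex_bij_witness[where i = sw and j = sw]) (use sw in auto)
    then show ?thesis by (simp add: sum_negf)
  qed
  finally show ?thesis by (simp add: sum_distrib_left)
qed

text \<open>
  The right-hand side of the equation that prescribes the boundary of \<open>c I\<close> is a cycle by the usual cancellation
  of signs, so acyclicity provides \<open>c I\<close>. The rainbow coefficient of \<open>c I\<close> is then 1 by induction
  on \<open>I\<close>: removing one colour \<open>i\<close>, the only term of the boundary with all remaining colours is
  \<open>c (I - {i})\<close>. For \<open>I\<close> a singleton the cycle lives on the empty face, so acyclicity includes that
  some vertex has that colour.
\<close>

lemma homological_Hall:
  fixes col :: "'v::linorder \<Rightarrow> 'c::linorder"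
  assumes N: "finite N" and mono: "mono_on N col" and M: "finite M"
    and X: "\<And>\<sigma>. \<sigma> \<in> X \<Longrightarrow> \<sigma> \<subseteq> N" and down: "\<And>\<sigma> \<tau>. \<lbrakk>\<sigma> \<in> X; \<tau> \<subseteq> \<sigma>\<rbrakk> \<Longrightarrow> \<tau> \<in> X"
    and X0: "{} \<in> X"
    and acyclic: "\<And>I z. \<lbrakk>I \<subseteq> M; I \<noteq> {};
        \<And>\<sigma>. z \<sigma> \<noteq> 0 \<Longrightarrow> \<sigma> \<in> X \<and> col ` \<sigma> \<subseteq> I \<and> card \<sigma> = card I - 1;
        \<And>\<rho>. boundary N z \<rho> = 0\<rbrakk> \<Longrightarrow>
      \<exists>y. (\<forall>\<sigma>. y \<sigma> \<noteq> 0 \<longrightarrow> \<sigma> \<in> X \<and> col ` \<sigma> \<subseteq> I \<and> card \<sigma> = card I) \<and> (\<forall>\<sigma>. boundary N y \<sigma> = z \<sigma>)"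
  shows "rainbow X col M \<noteq> {}"
proof -
  define good where "good = (\<lambda>c I. (\<forall>\<sigma>. c I \<sigma> \<noteq> 0 \<longrightarrow> \<sigma> \<in> X \<and> col ` \<sigma> \<subseteq> I \<and> card \<sigma> = card I) \<and>
     (\<forall>\<sigma>. boundary N (c I) \<sigma> = (\<Sum>i\<in>I. insertion_sign i (I - {i}) * c (I - {i}) \<sigma>)) \<and> (I = {} \<longrightarrow> c I {} = (1::real)))"
  have "\<exists>c. \<forall>I. I \<subseteq> M \<and> card I \<le> n \<longrightarrow> good c I" for n
  proof (induction n)
    case 0
    \<comment> \<open>The empty face, with coefficient 1, in degree -1 of the augmented chain complex.\<close>
    define c where "c = (\<lambda>(I::'c set) (\<sigma>::'v set). if \<sigma> = {} then 1 else (0::real))"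
    have "good c {}" using X0 by (auto simp: good_def c_def boundary_def)
    moreover have "I = {}" if "I \<subseteq> M" "card I \<le> 0" for I
      using that finite_subset[OF that(1) M] by simp
    ultimately show ?case by blast
  next
    case (Suc n)
    then obtain c where c: "\<And>I. \<lbrakk>I \<subseteq> M; card I \<le> n\<rbrakk> \<Longrightarrow> good c I" by blast
    define z where "z = (\<lambda>I \<sigma>. \<Sum>i\<in>I. insertion_sign i (I - {i}) * c (I - {i}) \<sigma>)"
    define fills where "fills = (\<lambda>y I. (\<forall>\<sigma>. y \<sigma> \<noteq> 0 \<longrightarrow> \<sigma> \<in> X \<and> col ` \<sigma> \<subseteq> I \<and> card \<sigma> = card I) \<and> (\<forall>\<sigma>. boundary N y \<sigma> = z I \<sigma>))"
    have ex: "\<exists>y. fills y I"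
      if I: "I \<subseteq> M" "card I = Suc n" for I
      unfolding fills_def
    proof (rule acyclic)
      have fI: "finite I" using I(1) M finite_subset by blast
      show "I \<subseteq> M" "I \<noteq> {}" using I by auto
      have gd: "good c (I - {i})" and cd: "card (I - {i}) = n" if "i \<in> I" for i
        using c[of "I - {i}"] I fI that by auto
      show "\<sigma> \<in> X \<and> col ` \<sigma> \<subseteq> I \<and> card \<sigma> = card I - 1" if "z I \<sigma> \<noteq> 0" for \<sigma>
      proof -
        obtain i where "i \<in> I" "insertion_sign i (I - {i}) * c (I - {i}) \<sigma> \<noteq> 0"
          using \<open>z I \<sigma> \<noteq> 0\<close> unfolding z_def by (rule sum.not_neutral_contains_not_neutral)
        then show ?thesis using gd[of i] cd[of i] I(2) by (auto simp: good_def)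
      qed
      fix \<rho>
      have "boundary N (z I) \<rho> = (\<Sum>i\<in>I. insertion_sign i (I - {i}) * boundary N (c (I - {i})) \<rho>)"
        unfolding boundary_def z_def sum_distrib_left by (subst sum.swap) (simp add: mult_ac)
      also have "\<dots> = (\<Sum>i\<in>I. \<Sum>j\<in>I - {i}. insertion_sign i (I - {i}) * insertion_sign j (I - {i} - {j}) * c (I - {i} - {j}) \<rho>)"
        using gd by (intro sum.cong refl) (simp add: good_def sum_distrib_left mult.assoc)
      also have "\<dots> = 0"
      proof (rule antisym_sum_0[OF fI])
        fix i j assume ij: "i \<in> I" "j \<in> I" "i \<noteq> j"
        define K where "K = I - {i} - {j}"
        have "finite K" "i \<notin> K" "j \<notin> K" "I - {i} = insert j K" "I - {j} = insert i K" "I - {j} - {i} = K"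
          using ij fI by (auto simp: K_def)
        note K = this
        have "insertion_sign i (insert j K) * insertion_sign j K = - (insertion_sign j (insert i K) * insertion_sign i K)"
          using insertion_sign_antisym[OF K(1-3) ij(3)] by (metis minus_minus mult.commute)
        then show "insertion_sign i (I - {i}) * insertion_sign j (I - {i} - {j}) * c (I - {i} - {j}) \<rho> =
           - (insertion_sign j (I - {j}) * insertion_sign i (I - {j} - {i}) * c (I - {j} - {i}) \<rho>)"
          by (simp only: K(6) K_def[symmetric]) (simp only: K(4,5) minus_mult_left)
      qed
      finally show "boundary N (z I) \<rho> = 0" .
    qed
    define c' where "c' = (\<lambda>I. if I \<subseteq> M \<and> card I = Suc n then (SOME y. fills y I) else c I)"
    have new: "fills (c' I) I"
      if "I \<subseteq> M" "card I = Suc n" for I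
      using someI_ex[OF ex[OF that]] that unfolding c'_def by simp
    have old: "c' I = c I" if "card I \<le> n" for I using that by (auto simp: c'_def)
    have "good c' I" if I: "I \<subseteq> M" "card I \<le> Suc n" for I
    proof -
      have fI: "finite I" using I(1) M finite_subset by blast
      have sub: "c' (I - {i}) = c (I - {i})" if "i \<in> I" for i
        using that I fI by (intro old) auto
      show ?thesis
      proof (cases "card I = Suc n")
        case True
        then show ?thesis using new[OF I(1) True] sub by (auto simp: good_def fills_def z_def)
      next
        case False
        then have "card I \<le> n" using I by simp
        then show ?thesis using c[OF I(1)] old[of I] sub by (auto simp: good_def)
      qed
    qed
    then show ?case by blast
  qed
  from this[of "card M"] obtain c where "\<forall>I. I \<subseteq> M \<and> card I \<le> card M \<longrightarrow> good c I" ..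
  then have c: "good c I" if "I \<subseteq> M" for I using that M by (simp add: card_mono)
  have one: "(\<Sum>\<sigma>\<in>rainbow X col I. c I \<sigma>) = 1" if "finite I" "I \<subseteq> M" for I
    using that
  proof (induction I rule: finite_induct)
    case empty
    have "rainbow X col {} = {{}}" using X0 by (auto simp: rainbow_def)
    then show ?case using c[of "{}"] by (simp add: good_def)
  next
    case (insert i J)
    let ?I = "insert i J"
    have gI: "good c ?I" using c insert.prems by blast
    have *: "(\<Sum>\<rho>\<in>rainbow X col J. boundary N (c ?I) \<rho>) = insertion_sign i J * (\<Sum>\<sigma>\<in>rainbow X col ?I. c ?I \<sigma>)"
      by (rule rainbow_sum_boundary[OF N mono X down insert.hyps(2)]) (use gI in \<open>auto simp: good_def\<close>)
    have "boundary N (c ?I) \<rho> = insertion_sign i J * c J \<rho>" if \<rho>: "\<rho> \<in> rainbow X col J" for \<rho>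
    proof -
      have z: "c (?I - {j}) \<rho> = 0" if "j \<in> J" for j
      proof (rule ccontr)
        assume "c (?I - {j}) \<rho> \<noteq> 0"
        moreover have "good c (?I - {j})" using c insert.prems by blast
        ultimately have "col ` \<rho> \<subseteq> ?I - {j}" by (auto simp: good_def)
        then show False using \<rho> that by (auto simp: rainbow_def)
      qed
      have "boundary N (c ?I) \<rho> = (\<Sum>k\<in>?I. insertion_sign k (?I - {k}) * c (?I - {k}) \<rho>)" using gI by (simp add: good_def)
      also have "\<dots> = insertion_sign i (?I - {i}) * c (?I - {i}) \<rho>" using insert.hyps z by simp
      finally show ?thesis using insert.hyps by simp
    qed
    then have "(\<Sum>\<rho>\<in>rainbow X col J. boundary N (c ?I) \<rho>) = insertion_sign i J * (\<Sum>\<rho>\<in>rainbow X col J. c J \<rho>)"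
      by (simp add: sum_distrib_left)
    with * insert have "insertion_sign i J * (\<Sum>\<sigma>\<in>rainbow X col ?I. c ?I \<sigma>) = insertion_sign i J" by simp
    moreover have "insertion_sign i J \<noteq> 0" by (simp add: insertion_sign_def)
    ultimately show ?case by simp
  qed
  then show ?thesis using M by force
qed

section \<open>The weighted Laplacian of the complex of disjoint edges\<close>

definition indep_complex :: "'v set \<Rightarrow> ('v \<Rightarrow> 'x set) \<Rightarrow> 'v set set" where
  "indep_complex N S = {\<sigma>. \<sigma> \<subseteq> N \<and> pairwise (\<lambda>u v. S u \<inter> S v = {}) \<sigma>}"

definition link :: "'v set \<Rightarrow> ('v \<Rightarrow> 'x set) \<Rightarrow> 'v set \<Rightarrow> 'v set" where
  "link N S \<rho> = {w\<in>N. \<forall>v\<in>\<rho>. S w \<inter> S v = {}}"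

abbreviation overlap :: "('v \<Rightarrow> 'x set) \<Rightarrow> 'v \<Rightarrow> 'v \<Rightarrow> real" where
  "overlap S u w \<equiv> real (card (S u \<inter> S w))"

lemma overlap_sum:
  assumes "finite V" "S u \<subseteq> V"
  shows "overlap S u w = (\<Sum>x\<in>V. of_bool (x \<in> S u) * of_bool (x \<in> S w))"
proof -
  have "V \<inter> {x. x \<in> S u \<and> x \<in> S w} = S u \<inter> S w" using assms by auto
  then show ?thesis using assms(1) by (simp add: of_bool_conj[symmetric] del: of_bool_conj)
qed

text \<open>
  The overlaps are the inner products of the indicator vectors of the sets \<open>S u\<close>.
\<close>

lemma overlap_psd:
  assumes L: "finite L" and S: "\<And>u. u \<in> L \<Longrightarrow> finite (S u)"
  shows "0 \<le> (\<Sum>u\<in>L. \<Sum>w\<in>L. overlap S u w * (c u * c w))"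
proof -
  define V where "V = (\<Union>u\<in>L. S u)"
  have V: "finite V" "\<And>u. u \<in> L \<Longrightarrow> S u \<subseteq> V" using L S by (auto simp: V_def)
  have "(\<Sum>u\<in>L. \<Sum>w\<in>L. overlap S u w * (c u * c w)) =
      (\<Sum>u\<in>L. \<Sum>w\<in>L. \<Sum>x\<in>V. (of_bool (x \<in> S u) * c u) * (of_bool (x \<in> S w) * c w))"
    using V by (intro sum.cong refl) (simp only: overlap_sum sum_distrib_right, simp only: mult_ac)
  also have "\<dots> = (\<Sum>u\<in>L. \<Sum>x\<in>V. \<Sum>w\<in>L. (of_bool (x \<in> S u) * c u) * (of_bool (x \<in> S w) * c w))"
    by (intro sum.cong refl sum.swap)
  also have "\<dots> = (\<Sum>x\<in>V. \<Sum>u\<in>L. \<Sum>w\<in>L. (of_bool (x \<in> S u) * c u) * (of_bool (x \<in> S w) * c w))"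
    by (rule sum.swap)
  also have "\<dots> = (\<Sum>x\<in>V. (\<Sum>u\<in>L. of_bool (x \<in> S u) * c u) * (\<Sum>w\<in>L. of_bool (x \<in> S w) * c w))"
    by (simp only: sum_product)
  also have "\<dots> \<ge> 0" by (intro sum_nonneg) simp
  finally show ?thesis .
qed

text \<open>
  Positive semidefiniteness bounds minus the form over intersecting pairs with all coefficients 1 by the form with
  coefficients \<open>overlap - 1\<close>. These are nonnegative on intersecting pairs, so \<open>2 x y \<le> x\<^sup>2 + y\<^sup>2\<close> together
  with symmetry makes the bound diagonal.
\<close>

lemma meeting_form_bound:
  assumes L: "finite L" and S: "\<And>u. u \<in> L \<Longrightarrow> finite (S u)" and g: "\<And>u. u \<in> L \<Longrightarrow> g u \<ge> 0"
  shows "- (\<Sum>u\<in>L. \<Sum>w\<in>{w\<in>L. S w \<inter> S u \<noteq> {}}. g u * g w * (b u * b w))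
    \<le> (\<Sum>u\<in>L. \<Sum>w\<in>{w\<in>L. S w \<inter> S u \<noteq> {}}. (overlap S u w - 1) * (g u * g w) * (b u)\<^sup>2)"
proof -
  define T where "T = (\<lambda>u w. if S w \<inter> S u \<noteq> {} then (overlap S u w - 1) * (g u * g w) else 0)"
  have Tsym: "T u w = T w u" for u w by (auto simp: T_def Int_commute)
  have Tpos: "T u w \<ge> 0" if "u \<in> L" "w \<in> L" for u w
  proof -
    have "card (S u \<inter> S w) \<ge> 1" if "S w \<inter> S u \<noteq> {}"
      using that S[OF \<open>u \<in> L\<close>] by (simp add: Suc_le_eq card_gt_0_iff Int_commute)
    then show ?thesis using g that by (auto simp: T_def)
  qed
  have filt: "(\<Sum>w\<in>{w\<in>L. S w \<inter> S u \<noteq> {}}. f w) = (\<Sum>w\<in>L. if S w \<inter> S u \<noteq> {} then f w else 0)" for f :: "_ \<Rightarrow> real" and u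
    using L by (simp add: sum.inter_filter)
  have split: "overlap S u w * (g u * b u * (g w * b w)) =
     (if S w \<inter> S u \<noteq> {} then g u * g w * (b u * b w) else 0) + T u w * (b u * b w)" for u w
    by (auto simp: T_def algebra_simps Int_commute)
  have "0 \<le> (\<Sum>u\<in>L. \<Sum>w\<in>L. overlap S u w * (g u * b u * (g w * b w)))"
    using L S by (rule overlap_psd)
  also have "\<dots> = (\<Sum>u\<in>L. \<Sum>w\<in>{w\<in>L. S w \<inter> S u \<noteq> {}}. g u * g w * (b u * b w)) + (\<Sum>u\<in>L. \<Sum>w\<in>L. T u w * (b u * b w))"
    unfolding split filt by (simp only: sum.distrib)
  finally have 1: "- (\<Sum>u\<in>L. \<Sum>w\<in>{w\<in>L. S w \<inter> S u \<noteq> {}}. g u * g w * (b u * b w)) \<le> (\<Sum>u\<in>L. \<Sum>w\<in>L. T u w * (b u * b w))"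
    by linarith
  have "(\<Sum>u\<in>L. \<Sum>w\<in>L. T u w * (b u * b w)) \<le> (\<Sum>u\<in>L. \<Sum>w\<in>L. T u w * (b u)\<^sup>2 / 2 + T u w * (b w)\<^sup>2 / 2)"
  proof (intro sum_mono)
    fix u w assume "u \<in> L" "w \<in> L"
    then have "0 \<le> T u w * (b u - b w)\<^sup>2" using Tpos by simp
    then show "T u w * (b u * b w) \<le> T u w * (b u)\<^sup>2 / 2 + T u w * (b w)\<^sup>2 / 2"
      by (simp add: power2_eq_square algebra_simps)
  qed
  also have "\<dots> = (\<Sum>u\<in>L. \<Sum>w\<in>L. T u w * (b u)\<^sup>2 / 2) + (\<Sum>u\<in>L. \<Sum>w\<in>L. T u w * (b w)\<^sup>2 / 2)"
    by (simp only: sum.distrib)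
  also have "(\<Sum>u\<in>L. \<Sum>w\<in>L. T u w * (b w)\<^sup>2 / 2) = (\<Sum>w\<in>L. \<Sum>u\<in>L. T w u * (b w)\<^sup>2 / 2)"
    by (subst sum.swap) (simp only: Tsym)
  also have "(\<Sum>u\<in>L. \<Sum>w\<in>L. T u w * (b u)\<^sup>2 / 2) + \<dots> = (\<Sum>u\<in>L. \<Sum>w\<in>L. T u w * (b u)\<^sup>2)"
    by (simp add: sum.distrib[symmetric])
  also have "\<dots> = (\<Sum>u\<in>L. \<Sum>w\<in>{w\<in>L. S w \<inter> S u \<noteq> {}}. (overlap S u w - 1) * (g u * g w) * (b u)\<^sup>2)"
    unfolding filt by (intro sum.cong refl) (simp add: T_def)
  finally show ?thesis using 1 by linarith
qed

text \<open>
  A Bochner-type argument. Let \<open>b \<rho> u\<close> be the value of \<open>\<phi>\<close> at \<open>insert u \<rho>\<close> with its sign. The cocycle condition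
  at \<open>insert w \<sigma>\<close> writes \<open>(\<phi> \<sigma>)\<^sup>2\<close> as a sum over \<open>u \<in> \<sigma>\<close> of products \<open>b (\<sigma> - {u}) u * b (\<sigma> - {u}) w\<close>, for
  each \<open>w\<close> in the link of \<open>\<sigma>\<close>. Summed over \<open>w\<close> with weights, the cycle condition at \<open>\<sigma> - {u}\<close>
  replaces the vertices of the link of \<open>\<sigma>\<close> by those in the link of \<open>\<sigma> - {u}\<close> that meet \<open>u\<close>. Regrouping by
  \<open>\<rho> = \<sigma> - {u}\<close> produces exactly the form of \<open>meeting_form_bound\<close>. What remains is that a
  sum of squares with coefficients \<open>D \<sigma> - (\<Sum>u\<in>\<sigma>. R (\<sigma> - {u}) u)\<close>, times the positive
  weight \<open>G \<sigma>\<close> of the face, is at most 0.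

  These coefficients are positive: a vertex \<open>w\<close> contributes at least \<open>g w * (1 - (\<Sum>u\<in>\<sigma>. overlap S u w))\<close>,
  as is seen by distinguishing whether \<open>S w\<close> meets none, one or several of the sets in \<open>\<sigma>\<close>, and the
  sum of these bounds over \<open>w\<close> is positive by the assumption on the weights.
\<close>

lemma harmonic_vanishes:
  fixes S :: "'v::linorder \<Rightarrow> 'x set" and g :: "'v \<Rightarrow> real" and \<phi> :: "'v set \<Rightarrow> real"
  assumes N: "finite N" "N \<noteq> {}" and S: "\<And>u. u \<in> N \<Longrightarrow> finite (S u)" "\<And>u. u \<in> N \<Longrightarrow> S u \<noteq> {}"
    and g: "\<And>u. u \<in> N \<Longrightarrow> g u > 0"
    and narrow: "\<And>u. u \<in> N \<Longrightarrow> real K * (\<Sum>w\<in>N. overlap S u w * g w) < (\<Sum>w\<in>N. g w)"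
    and cycle: "\<And>\<rho>. \<lbrakk>\<rho> \<in> indep_complex N S; Suc (card \<rho>) = K\<rbrakk> \<Longrightarrow>
        (\<Sum>w\<in>link N S \<rho>. g w * (insertion_sign w \<rho> * \<phi> (insert w \<rho>))) = 0"
    and cocycle: "\<And>\<tau>. \<lbrakk>\<tau> \<in> indep_complex N S; card \<tau> = Suc K\<rbrakk> \<Longrightarrow>
        (\<Sum>u\<in>\<tau>. insertion_sign u (\<tau> - {u}) * \<phi> (\<tau> - {u})) = 0"
    and \<sigma>0: "\<sigma>0 \<in> indep_complex N S" "card \<sigma>0 = K"
  shows "\<phi> \<sigma>0 = 0"
proof -
  define lk where "lk = link N S"
  define X where "X = {\<sigma>\<in>indep_complex N S. card \<sigma> = K}"
  define Y where "Y = {\<rho>\<in>indep_complex N S. Suc (card \<rho>) = K}"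
  define inc where "inc = (\<lambda>\<rho> u. {w\<in>lk \<rho>. S w \<inter> S u \<noteq> {}})"
  define b where "b = (\<lambda>\<rho> u. insertion_sign u \<rho> * \<phi> (insert u \<rho>))"
  define G where "G = (\<lambda>\<sigma>. \<Prod>v\<in>\<sigma>. g v)"
  have fin: "finite \<sigma>" "\<sigma> \<subseteq> N" if "\<sigma> \<in> indep_complex N S" for \<sigma>
    using that N(1) by (auto simp: indep_complex_def intro: finite_subset)
  have finlk: "finite (lk \<rho>)" "lk \<rho> \<subseteq> N" for \<rho> using N(1) by (auto simp: lk_def link_def)
  have "indep_complex N S \<subseteq> Pow N" by (auto simp: indep_complex_def)
  then have "finite (indep_complex N S)" using N(1) finite_subset by blast
  then have fX: "finite X" "finite Y" by (auto simp: X_def Y_def)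
  have sub: "\<sigma> - {u} \<in> indep_complex N S" if "\<sigma> \<in> indep_complex N S" for \<sigma> u
    using that by (auto simp: indep_complex_def pairwise_def)
  have lk_notin: "w \<notin> \<rho>" if "w \<in> lk \<rho>" for w \<rho>
    using that S(2) by (fastforce simp: lk_def link_def)
  have ins: "insert w \<rho> \<in> indep_complex N S" if "\<rho> \<in> indep_complex N S" "w \<in> lk \<rho>" for w \<rho>
    using that by (auto simp: indep_complex_def lk_def link_def pairwise_insert Int_commute)
  have in_lk: "u \<in> lk (\<sigma> - {u})" if "\<sigma> \<in> indep_complex N S" "u \<in> \<sigma>" for \<sigma> u
    using that by (auto simp: indep_complex_def lk_def link_def pairwise_def)
  have Gpos: "G \<sigma> > 0" if "\<sigma> \<in> indep_complex N S" for \<sigma>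
    using fin[OF that] g by (auto simp: G_def intro!: prod_pos)

  \<comment> \<open>Flags of a face with K vertices and one of its vertices, counted from either end. For \<open>K = 0\<close> both
      sides are empty.\<close>
  have swap: "(\<Sum>\<sigma>\<in>X. \<Sum>u\<in>\<sigma>. h (\<sigma> - {u}) u) = (\<Sum>\<rho>\<in>Y. \<Sum>u\<in>lk \<rho>. h \<rho> u)"
    for h :: "'v set \<Rightarrow> 'v \<Rightarrow> real"
  proof -
    have "(\<Sum>\<sigma>\<in>X. \<Sum>u\<in>\<sigma>. h (\<sigma> - {u}) u) = (\<Sum>(\<sigma>, u)\<in>Sigma X (\<lambda>\<sigma>. \<sigma>). h (\<sigma> - {u}) u)"
      using fX fin by (intro sum.Sigma) (auto simp: X_def)
    also have "\<dots> = (\<Sum>(\<rho>, u)\<in>Sigma Y lk. h \<rho> u)"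
    proof (rule sum.reindex_bij_witness[where i = "\<lambda>(\<rho>, u). (insert u \<rho>, u)" and j = "\<lambda>(\<sigma>, u). (\<sigma> - {u}, u)"])
      fix p assume "p \<in> Sigma X (\<lambda>\<sigma>. \<sigma>)"
      then obtain \<sigma> u where p: "p = (\<sigma>, u)" "\<sigma> \<in> indep_complex N S" "card \<sigma> = K" "u \<in> \<sigma>" by (auto simp: X_def)
      then have "Suc (card (\<sigma> - {u})) = K" using fin(1) by (metis card_Suc_Diff1)
      then show "(\<lambda>(\<sigma>, u). (\<sigma> - {u}, u)) p \<in> Sigma Y lk"
        using p sub in_lk by (simp add: Y_def)
      show "(\<lambda>(\<rho>, u). (insert u \<rho>, u)) ((\<lambda>(\<sigma>, u). (\<sigma> - {u}, u)) p) = p" using p by auto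
      show "(\<lambda>(\<rho>, u). h \<rho> u) ((\<lambda>(\<sigma>, u). (\<sigma> - {u}, u)) p) = (\<lambda>(\<sigma>, u). h (\<sigma> - {u}) u) p" using p by simp
    next
      fix p assume "p \<in> Sigma Y lk"
      then obtain \<rho> u where p: "p = (\<rho>, u)" "\<rho> \<in> indep_complex N S" "Suc (card \<rho>) = K" "u \<in> lk \<rho>" by (auto simp: Y_def)
      then show "(\<lambda>(\<rho>, u). (insert u \<rho>, u)) p \<in> Sigma X (\<lambda>\<sigma>. \<sigma>)"
        using ins lk_notin fin(1)[of \<rho>] by (simp add: X_def)
      show "(\<lambda>(\<sigma>, u). (\<sigma> - {u}, u)) ((\<lambda>(\<rho>, u). (insert u \<rho>, u)) p) = p" using p lk_notin[of u \<rho>] by simp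
    qed
    also have "\<dots> = (\<Sum>\<rho>\<in>Y. \<Sum>u\<in>lk \<rho>. h \<rho> u)"
      using fX finlk by (intro sum.Sigma[symmetric]) auto
    finally show ?thesis .
  qed

  have via_cocycle: "(\<phi> \<sigma>)\<^sup>2 = (\<Sum>u\<in>\<sigma>. b (\<sigma> - {u}) u * b (\<sigma> - {u}) w)"
    if \<sigma>: "\<sigma> \<in> X" and w: "w \<in> lk \<sigma>" for \<sigma> w
  proof -
    have \<sigma>': "\<sigma> \<in> indep_complex N S" "card \<sigma> = K" "finite \<sigma>" "w \<notin> \<sigma>"
      using \<sigma> fin lk_notin[OF w] by (auto simp: X_def)
    have "card (insert w \<sigma>) = Suc K" using \<sigma>' by simp
    then have "0 = (\<Sum>u\<in>insert w \<sigma>. insertion_sign u (insert w \<sigma> - {u}) * \<phi> (insert w \<sigma> - {u}))"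
      using cocycle[OF ins[OF \<sigma>'(1) w]] by simp
    also have "\<dots> = insertion_sign w \<sigma> * \<phi> \<sigma> + (\<Sum>u\<in>\<sigma>. insertion_sign u (insert w \<sigma> - {u}) * \<phi> (insert w \<sigma> - {u}))"
      using \<sigma>' by simp
    finally have "insertion_sign w \<sigma> * \<phi> \<sigma> = - (\<Sum>u\<in>\<sigma>. insertion_sign u (insert w \<sigma> - {u}) * \<phi> (insert w \<sigma> - {u}))" by linarith
    then have "(insertion_sign w \<sigma> * \<phi> \<sigma>) * (insertion_sign w \<sigma> * \<phi> \<sigma>) =
      - (insertion_sign w \<sigma> * \<phi> \<sigma> * (\<Sum>u\<in>\<sigma>. insertion_sign u (insert w \<sigma> - {u}) * \<phi> (insert w \<sigma> - {u})))" by simp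
    also have "\<dots> = (\<Sum>u\<in>\<sigma>. b (\<sigma> - {u}) u * b (\<sigma> - {u}) w)"
      unfolding sum_distrib_left sum_negf[symmetric]
    proof (rule sum.cong[OF refl])
      fix u assume u: "u \<in> \<sigma>"
      define \<rho> where "\<rho> = \<sigma> - {u}"
      have \<rho>: "finite \<rho>" "u \<notin> \<rho>" "w \<notin> \<rho>" "u \<noteq> w" "\<sigma> = insert u \<rho>" "insert w \<sigma> - {u} = insert w \<rho>"
        using \<sigma>' u by (auto simp: \<rho>_def)
      have "- (insertion_sign w \<sigma> * \<phi> \<sigma> * (insertion_sign u (insert w \<sigma> - {u}) * \<phi> (insert w \<sigma> - {u}))) =
         - (insertion_sign u (insert w \<rho>) * insertion_sign w (insert u \<rho>)) * (\<phi> (insert u \<rho>) * \<phi> (insert w \<rho>))"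
        unfolding \<rho>(6) unfolding \<rho>(5) by (simp add: mult_ac)
      also have "\<dots> = b \<rho> u * b \<rho> w" by (simp add: insertion_sign_exchange[OF \<rho>(1-4)] b_def)
      finally show "- (insertion_sign w \<sigma> * \<phi> \<sigma> * (insertion_sign u (insert w \<sigma> - {u}) * \<phi> (insert w \<sigma> - {u}))) =
          b (\<sigma> - {u}) u * b (\<sigma> - {u}) w" unfolding \<rho>_def[symmetric] .
    qed
    also have "(insertion_sign w \<sigma> * \<phi> \<sigma>) * (insertion_sign w \<sigma> * \<phi> \<sigma>) = (insertion_sign w \<sigma> * insertion_sign w \<sigma>) * (\<phi> \<sigma>)\<^sup>2"
      by (simp only: power2_eq_square mult_ac)
    finally show ?thesis by simp
  qed

  have via_cycle: "(\<Sum>w\<in>lk (insert u \<rho>). g w * b \<rho> w) = - (\<Sum>w\<in>inc \<rho> u. g w * b \<rho> w)"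
    if "\<rho> \<in> Y" for \<rho> u
  proof -
    have "lk \<rho> = lk (insert u \<rho>) \<union> inc \<rho> u" "lk (insert u \<rho>) \<inter> inc \<rho> u = {}"
      by (auto simp: lk_def link_def inc_def)
    moreover have "finite (inc \<rho> u)" using finlk by (simp add: inc_def)
    ultimately have "(\<Sum>w\<in>lk \<rho>. g w * b \<rho> w) = (\<Sum>w\<in>lk (insert u \<rho>). g w * b \<rho> w) + (\<Sum>w\<in>inc \<rho> u. g w * b \<rho> w)"
      using finlk sum.union_disjoint by metis
    moreover have "(\<Sum>w\<in>lk \<rho>. g w * b \<rho> w) = 0" using cycle[of \<rho>] that by (simp add: Y_def lk_def b_def)
    ultimately show ?thesis by linarith
  qed

  define D where "D = (\<lambda>\<sigma>. \<Sum>w\<in>lk \<sigma>. g w)"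
  define R where "R = (\<lambda>\<rho> u. \<Sum>w\<in>inc \<rho> u. (overlap S u w - 1) * g w)"
  have local: "D \<sigma> * (\<phi> \<sigma>)\<^sup>2 = - (\<Sum>u\<in>\<sigma>. \<Sum>w\<in>inc (\<sigma> - {u}) u. g w * (b (\<sigma> - {u}) u * b (\<sigma> - {u}) w))"
    if \<sigma>: "\<sigma> \<in> X" for \<sigma>
  proof -
    have "D \<sigma> * (\<phi> \<sigma>)\<^sup>2 = (\<Sum>w\<in>lk \<sigma>. g w * (\<phi> \<sigma>)\<^sup>2)" by (simp add: D_def sum_distrib_right)
    also have "\<dots> = (\<Sum>w\<in>lk \<sigma>. g w * (\<Sum>u\<in>\<sigma>. b (\<sigma> - {u}) u * b (\<sigma> - {u}) w))"
      using via_cocycle[OF \<sigma>] by (intro sum.cong) auto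
    also have "\<dots> = (\<Sum>u\<in>\<sigma>. b (\<sigma> - {u}) u * (\<Sum>w\<in>lk \<sigma>. g w * b (\<sigma> - {u}) w))"
      unfolding sum_distrib_left by (subst sum.swap) (simp only: mult_ac)
    also have "\<dots> = (\<Sum>u\<in>\<sigma>. b (\<sigma> - {u}) u * - (\<Sum>w\<in>inc (\<sigma> - {u}) u. g w * b (\<sigma> - {u}) w))"
    proof (rule sum.cong[OF refl])
      fix u assume u: "u \<in> \<sigma>"
      have "finite \<sigma>" using \<sigma> fin by (auto simp: X_def)
      then have "Suc (card (\<sigma> - {u})) = card \<sigma>" using u by (rule card_Suc_Diff1)
      then have "Suc (card (\<sigma> - {u})) = K" using \<sigma> by (simp add: X_def)
      then have "\<sigma> - {u} \<in> Y" using \<sigma> sub by (simp add: X_def Y_def)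
      from via_cycle[OF this, of u] show "b (\<sigma> - {u}) u * (\<Sum>w\<in>lk \<sigma>. g w * b (\<sigma> - {u}) w) =
          b (\<sigma> - {u}) u * - (\<Sum>w\<in>inc (\<sigma> - {u}) u. g w * b (\<sigma> - {u}) w)"
        using u by (simp add: insert_absorb)
    qed
    also have "\<dots> = - (\<Sum>u\<in>\<sigma>. \<Sum>w\<in>inc (\<sigma> - {u}) u. g w * (b (\<sigma> - {u}) u * b (\<sigma> - {u}) w))"
      by (simp add: sum_negf sum_distrib_left mult_ac)
    finally show ?thesis .
  qed
  have Gdel: "G \<sigma> = G (\<sigma> - {u}) * g u" if "\<sigma> \<in> X" "u \<in> \<sigma>" for \<sigma> u
    using that fin by (auto simp: G_def X_def prod.remove mult.commute)
  have bsq: "(b (\<sigma> - {u}) u)\<^sup>2 = (\<phi> \<sigma>)\<^sup>2" if "u \<in> \<sigma>" for \<sigma> u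
    using that by (simp add: b_def power_mult_distrib insert_absorb power2_eq_square[of "insertion_sign _ _"])

  have "(\<Sum>\<sigma>\<in>X. G \<sigma> * (D \<sigma> * (\<phi> \<sigma>)\<^sup>2)) =
    (\<Sum>\<sigma>\<in>X. \<Sum>u\<in>\<sigma>. - (G (\<sigma> - {u}) * (\<Sum>w\<in>inc (\<sigma> - {u}) u. g u * g w * (b (\<sigma> - {u}) u * b (\<sigma> - {u}) w))))"
  proof (rule sum.cong[OF refl])
    fix \<sigma> assume \<sigma>: "\<sigma> \<in> X"
    show "G \<sigma> * (D \<sigma> * (\<phi> \<sigma>)\<^sup>2) = (\<Sum>u\<in>\<sigma>. - (G (\<sigma> - {u}) * (\<Sum>w\<in>inc (\<sigma> - {u}) u. g u * g w * (b (\<sigma> - {u}) u * b (\<sigma> - {u}) w))))"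
      unfolding sum_negf local[OF \<sigma>] mult_minus_right sum_distrib_left
      by (intro arg_cong[where f = uminus] sum.cong refl) (simp add: Gdel[OF \<sigma>])
  qed
  also have "\<dots> = (\<Sum>\<rho>\<in>Y. \<Sum>u\<in>lk \<rho>. - (G \<rho> * (\<Sum>w\<in>inc \<rho> u. g u * g w * (b \<rho> u * b \<rho> w))))"
    by (rule swap)
  also have "\<dots> = (\<Sum>\<rho>\<in>Y. G \<rho> * - (\<Sum>u\<in>lk \<rho>. \<Sum>w\<in>inc \<rho> u. g u * g w * (b \<rho> u * b \<rho> w)))"
    by (simp only: sum_negf sum_distrib_left mult_minus_right)
  also have "\<dots> \<le> (\<Sum>\<rho>\<in>Y. G \<rho> * (\<Sum>u\<in>lk \<rho>. \<Sum>w\<in>inc \<rho> u. (overlap S u w - 1) * (g u * g w) * (b \<rho> u)\<^sup>2))"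
  proof (rule sum_mono)
    fix \<rho> assume "\<rho> \<in> Y"
    then have "G \<rho> \<ge> 0" using Gpos by (auto simp: Y_def less_imp_le)
    moreover have "- (\<Sum>u\<in>lk \<rho>. \<Sum>w\<in>inc \<rho> u. g u * g w * (b \<rho> u * b \<rho> w))
      \<le> (\<Sum>u\<in>lk \<rho>. \<Sum>w\<in>inc \<rho> u. (overlap S u w - 1) * (g u * g w) * (b \<rho> u)\<^sup>2)"
      unfolding inc_def
    proof (rule meeting_form_bound)
      show "finite (lk \<rho>)" by (rule finlk)
      show "finite (S u)" "0 \<le> g u" if "u \<in> lk \<rho>" for u
        using that finlk(2)[of \<rho>] S(1) g less_imp_le by blast+
    qed
    ultimately show "G \<rho> * - (\<Sum>u\<in>lk \<rho>. \<Sum>w\<in>inc \<rho> u. g u * g w * (b \<rho> u * b \<rho> w))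
      \<le> G \<rho> * (\<Sum>u\<in>lk \<rho>. \<Sum>w\<in>inc \<rho> u. (overlap S u w - 1) * (g u * g w) * (b \<rho> u)\<^sup>2)"
      by (rule mult_left_mono[rotated])
  qed
  also have "\<dots> = (\<Sum>\<rho>\<in>Y. \<Sum>u\<in>lk \<rho>. G \<rho> * (g u * R \<rho> u * (b \<rho> u)\<^sup>2))"
    by (simp only: R_def sum_distrib_left sum_distrib_right mult_ac)
  also have "\<dots> = (\<Sum>\<sigma>\<in>X. \<Sum>u\<in>\<sigma>. G (\<sigma> - {u}) * (g u * R (\<sigma> - {u}) u * (b (\<sigma> - {u}) u)\<^sup>2))"
    by (rule swap[symmetric])
  also have "\<dots> = (\<Sum>\<sigma>\<in>X. G \<sigma> * ((\<Sum>u\<in>\<sigma>. R (\<sigma> - {u}) u) * (\<phi> \<sigma>)\<^sup>2))"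
    unfolding sum_distrib_left sum_distrib_right
    by (intro sum.cong refl) (simp add: Gdel bsq mult_ac)
  finally have energy: "(\<Sum>\<sigma>\<in>X. G \<sigma> * (D \<sigma> - (\<Sum>u\<in>\<sigma>. R (\<sigma> - {u}) u)) * (\<phi> \<sigma>)\<^sup>2) \<le> 0"
    by (simp add: algebra_simps sum_subtractf)

  have gap: "D \<sigma> - (\<Sum>u\<in>\<sigma>. R (\<sigma> - {u}) u) > 0" if "\<sigma> \<in> X" for \<sigma>
  proof -
    have \<sigma>: "\<sigma> \<in> indep_complex N S" "card \<sigma> = K" "finite \<sigma>" "\<sigma> \<subseteq> N" using that fin by (auto simp: X_def)
    define r where "r = (\<lambda>w u. if w \<in> inc (\<sigma> - {u}) u then overlap S u w - 1 else 0)"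
    have per_vertex: "1 - (\<Sum>u\<in>\<sigma>. overlap S u w) \<le> of_bool (w \<in> lk \<sigma>) - (\<Sum>u\<in>\<sigma>. r w u)" if w: "w \<in> N" for w
    proof -
      define M where "M = {u\<in>\<sigma>. S w \<inter> S u \<noteq> {}}"
      have fM: "finite M" using \<sigma> by (simp add: M_def)
      have ov0: "overlap S u w = 0" if "u \<in> \<sigma> - M" for u using that by (auto simp: M_def Int_commute)
      have ov1: "overlap S u w \<ge> 1" if "u \<in> M" for u
      proof -
        have "card (S u \<inter> S w) > 0" using that S(1)[OF w] by (auto simp: M_def card_gt_0_iff Int_commute)
        then show ?thesis by simp
      qed
      have oM: "(\<Sum>u\<in>\<sigma>. overlap S u w) = (\<Sum>u\<in>M. overlap S u w)"
        using \<sigma>(3) ov0 by (intro sum.mono_neutral_right) (auto simp: M_def)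
      \<comment> \<open>A vertex of \<open>\<sigma>\<close> meets itself, since its set is nonempty; so it counts as meeting exactly one.\<close>
      have inc_iff: "w \<in> inc (\<sigma> - {u}) u \<longleftrightarrow> M = {u}" if "u \<in> \<sigma>" for u
        using that w by (auto simp: inc_def lk_def link_def M_def)
      have lk_iff: "w \<in> lk \<sigma> \<longleftrightarrow> M = {}" using w by (auto simp: lk_def link_def M_def)
      consider "M = {}" | v where "M = {v}" | "card M \<ge> 2"
        using fM by (metis One_nat_def Suc_1 card_0_eq card_1_singletonE le_neq_implies_less less_one not_less_eq_eq not_le)
      then show ?thesis
      proof cases
        case 1
        then have "(\<Sum>u\<in>\<sigma>. r w u) = 0" by (intro sum.neutral) (auto simp: r_def inc_iff)
        then show ?thesis using 1 by (simp add: oM lk_iff)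
      next
        case 2
        then have v: "v \<in> \<sigma>" by (auto simp: M_def)
        have "(\<Sum>u\<in>\<sigma>. r w u) = (\<Sum>u\<in>\<sigma>. if u = v then overlap S v w - 1 else 0)"
          using 2 by (intro sum.cong) (auto simp: r_def inc_iff)
        also have "\<dots> = overlap S v w - 1" using v \<sigma>(3) by simp
        finally show ?thesis using 2 by (simp add: oM lk_iff)
      next
        case 3
        then have ne: "M \<noteq> {}" "\<And>u. M \<noteq> {u}" by auto
        then have "(\<Sum>u\<in>\<sigma>. r w u) = 0" by (intro sum.neutral) (auto simp: r_def inc_iff)
        moreover have "(\<Sum>u\<in>M. overlap S u w) \<ge> (\<Sum>u\<in>M. 1)" using ov1 by (intro sum_mono)
        ultimately show ?thesis using 3 by (simp add: oM)
      qed
    qed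
    have Dsum: "D \<sigma> = (\<Sum>w\<in>N. of_bool (w \<in> lk \<sigma>) * g w)"
      unfolding D_def using N(1) finlk by (intro sum.mono_neutral_cong_left) auto
    have Rsum: "R (\<sigma> - {u}) u = (\<Sum>w\<in>N. r w u * g w)" for u
      unfolding R_def using N(1) finlk(2)[of "\<sigma> - {u}"]
      by (intro sum.mono_neutral_cong_left) (auto simp: r_def inc_def)
    have "(\<Sum>u\<in>\<sigma>. \<Sum>w\<in>N. overlap S u w * g w) < (\<Sum>w\<in>N. g w)"
    proof (cases "\<sigma> = {}")
      case True
      then show ?thesis using N g by (simp add: sum_pos)
    next
      case False
      then have K: "K > 0" using \<sigma> by auto
      have "(\<Sum>u\<in>\<sigma>. \<Sum>w\<in>N. overlap S u w * g w) < (\<Sum>u\<in>\<sigma>. (\<Sum>w\<in>N. g w) / real K)"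
      proof (rule sum_strict_mono[OF \<sigma>(3) False])
        fix u assume "u \<in> \<sigma>"
        then have "real K * (\<Sum>w\<in>N. overlap S u w * g w) < (\<Sum>w\<in>N. g w)" using narrow \<sigma>(4) by blast
        then show "(\<Sum>w\<in>N. overlap S u w * g w) < (\<Sum>w\<in>N. g w) / real K" using K by (simp add: field_simps)
      qed
      also have "\<dots> = (\<Sum>w\<in>N. g w)" using K \<sigma>(2) by simp
      finally show ?thesis .
    qed
    moreover have "(\<Sum>u\<in>\<sigma>. \<Sum>w\<in>N. overlap S u w * g w) = (\<Sum>w\<in>N. (\<Sum>u\<in>\<sigma>. overlap S u w) * g w)"
      by (subst sum.swap) (simp only: sum_distrib_right)
    moreover have "(\<Sum>w\<in>N. (1 - (\<Sum>u\<in>\<sigma>. overlap S u w)) * g w) \<le> (\<Sum>w\<in>N. (of_bool (w \<in> lk \<sigma>) - (\<Sum>u\<in>\<sigma>. r w u)) * g w)"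
      using per_vertex g by (intro sum_mono mult_right_mono) (auto simp: less_imp_le)
    moreover have "(\<Sum>w\<in>N. (1 - (\<Sum>u\<in>\<sigma>. overlap S u w)) * g w) = (\<Sum>w\<in>N. g w) - (\<Sum>w\<in>N. (\<Sum>u\<in>\<sigma>. overlap S u w) * g w)"
      by (simp only: left_diff_distrib sum_subtractf mult_1_left)
    moreover have "(\<Sum>w\<in>N. (of_bool (w \<in> lk \<sigma>) - (\<Sum>u\<in>\<sigma>. r w u)) * g w) = D \<sigma> - (\<Sum>w\<in>N. (\<Sum>u\<in>\<sigma>. r w u) * g w)"
      by (simp only: left_diff_distrib sum_subtractf Dsum)
    moreover have "(\<Sum>w\<in>N. (\<Sum>u\<in>\<sigma>. r w u) * g w) = (\<Sum>u\<in>\<sigma>. R (\<sigma> - {u}) u)"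
      unfolding Rsum sum_distrib_right by (rule sum.swap)
    ultimately show ?thesis by linarith
  qed
  have terms: "0 \<le> G \<sigma> * (D \<sigma> - (\<Sum>u\<in>\<sigma>. R (\<sigma> - {u}) u)) * (\<phi> \<sigma>)\<^sup>2" if "\<sigma> \<in> X" for \<sigma>
    using gap[OF that] Gpos[of \<sigma>] that by (simp add: X_def less_imp_le)
  then have "(\<Sum>\<sigma>\<in>X. G \<sigma> * (D \<sigma> - (\<Sum>u\<in>\<sigma>. R (\<sigma> - {u}) u)) * (\<phi> \<sigma>)\<^sup>2) = 0"
    using energy by (intro antisym sum_nonneg)
  then have "\<forall>\<sigma>\<in>X. G \<sigma> * (D \<sigma> - (\<Sum>u\<in>\<sigma>. R (\<sigma> - {u}) u)) * (\<phi> \<sigma>)\<^sup>2 = 0"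
    by (subst (asm) sum_nonneg_eq_0_iff[OF fX(1)]) (erule terms | assumption)+
  moreover have "\<sigma>0 \<in> X" using \<sigma>0 by (simp add: X_def)
  ultimately show ?thesis using gap[of \<sigma>0] Gpos[OF \<sigma>0(1)] by auto
qed

text \<open>
  Chains carry the inner product in which a face has weight \<open>1 / (\<Prod>v\<in>\<sigma>. g v)\<close>. The component \<open>r\<close> of \<open>z\<close>
  orthogonal to the boundaries is a cycle, and \<open>\<phi> \<sigma> = r \<sigma> / (\<Prod>v\<in>\<sigma>. g v)\<close> satisfies the two conditions of
  \<open>harmonic_vanishes\<close>: orthogonality to the boundary of \<open>\<tau>\<close> is the cocycle condition at \<open>\<tau>\<close>, and the
  factor \<open>g w\<close> in the cycle condition comes from rescaling by the weights.
\<close>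

lemma cycle_is_boundary:
  fixes S :: "'v::linorder \<Rightarrow> 'x set" and g :: "'v \<Rightarrow> real"
  assumes N: "finite N" and W: "W \<subseteq> N" "W \<noteq> {}"
    and S: "\<And>u. u \<in> W \<Longrightarrow> finite (S u)" "\<And>u. u \<in> W \<Longrightarrow> S u \<noteq> {}"
    and g: "\<And>u. u \<in> W \<Longrightarrow> g u > 0"
    and narrow: "\<And>u. u \<in> W \<Longrightarrow> real K * (\<Sum>w\<in>W. overlap S u w * g w) < (\<Sum>w\<in>W. g w)"
    and z: "\<And>\<sigma>. z \<sigma> \<noteq> 0 \<Longrightarrow> \<sigma> \<in> indep_complex W S \<and> card \<sigma> = K"
    and cycle: "\<And>\<rho>. boundary N z \<rho> = 0"
  shows "\<exists>y. (\<forall>\<sigma>. y \<sigma> \<noteq> 0 \<longrightarrow> \<sigma> \<in> indep_complex W S \<and> card \<sigma> = Suc K) \<and> (\<forall>\<sigma>. boundary N y \<sigma> = z \<sigma>)"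
proof -
  define T where "T = {\<tau>\<in>indep_complex W S. card \<tau> = Suc K}"
  define D where "D = {\<sigma>\<in>indep_complex W S. card \<sigma> = K}"
  define b where "b = (\<lambda>\<tau> (\<sigma> :: 'v set). \<Sum>u\<in>\<tau>. if \<sigma> = \<tau> - {u} then insertion_sign u \<sigma> else 0)"
  define h where "h = (\<lambda>\<sigma>. 1 / (\<Prod>v\<in>\<sigma>. g v))"
  have fW: "finite W" using N W(1) finite_subset by blast
  have fin: "finite \<sigma>" "\<sigma> \<subseteq> W" if "\<sigma> \<in> indep_complex W S" for \<sigma>
    using that fW by (auto simp: indep_complex_def intro: finite_subset)
  have "indep_complex W S \<subseteq> Pow W" by (auto simp: indep_complex_def)
  then have "finite (indep_complex W S)" using fW finite_subset by blast
  then have fTD: "finite T" "finite D" by (auto simp: T_def D_def)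
  have sub: "\<sigma> \<in> indep_complex W S" if "\<tau> \<in> indep_complex W S" "\<sigma> \<subseteq> \<tau>" for \<sigma> \<tau>
    using that by (auto simp: indep_complex_def intro: pairwise_subset)
  have hpos: "h \<sigma> > 0" if "\<sigma> \<in> indep_complex W S" for \<sigma>
    using fin[OF that] g by (auto simp: h_def intro!: prod_pos)
  obtain y0 where y0: "\<forall>\<tau>\<in>T. (\<Sum>\<sigma>\<in>D. h \<sigma> * (z \<sigma> - (\<Sum>s\<in>T. y0 s * b s \<sigma>)) * b \<tau> \<sigma>) = 0"
    using orthogonal_decomposition[OF fTD, of h z b] hpos by (auto simp: D_def)
  define y where "y = (\<lambda>\<tau>. if \<tau> \<in> T then y0 \<tau> else 0)"
  define r where "r = (\<lambda>\<sigma>. z \<sigma> - boundary N y \<sigma>)"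
  define \<phi> where "\<phi> = (\<lambda>\<sigma>. h \<sigma> * r \<sigma>)"
  have boundary_y: "boundary N y \<sigma> = (\<Sum>\<tau>\<in>T. y0 \<tau> * b \<tau> \<sigma>)" for \<sigma>
  proof -
    have b': "b \<tau> \<sigma> = (\<Sum>u\<in>N - \<sigma>. if insert u \<sigma> = \<tau> then insertion_sign u \<sigma> else 0)" if "\<tau> \<in> T" for \<tau>
    proof -
      have "finite \<tau>" "\<tau> \<subseteq> N" using that fin W(1) by (auto simp: T_def)
      then have "{u\<in>\<tau>. \<sigma> = \<tau> - {u}} = {u\<in>N - \<sigma>. insert u \<sigma> = \<tau>}" by auto
      moreover have "finite (N - \<sigma>)" using N by simp
      ultimately show ?thesis using \<open>finite \<tau>\<close> by (simp only: b_def sum.inter_filter[symmetric])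
    qed
    have "boundary N y \<sigma> = (\<Sum>u\<in>N - \<sigma>. \<Sum>\<tau>\<in>T. if insert u \<sigma> = \<tau> then y0 \<tau> * insertion_sign u \<sigma> else 0)"
      unfolding boundary_def using fTD(1) by (intro sum.cong refl) (simp add: y_def)
    also have "\<dots> = (\<Sum>\<tau>\<in>T. \<Sum>u\<in>N - \<sigma>. if insert u \<sigma> = \<tau> then y0 \<tau> * insertion_sign u \<sigma> else 0)"
      by (rule sum.swap)
    also have "\<dots> = (\<Sum>\<tau>\<in>T. y0 \<tau> * b \<tau> \<sigma>)"
    proof (rule sum.cong[OF refl])
      fix \<tau> assume "\<tau> \<in> T"
      show "(\<Sum>u\<in>N - \<sigma>. if insert u \<sigma> = \<tau> then y0 \<tau> * insertion_sign u \<sigma> else 0) = y0 \<tau> * b \<tau> \<sigma>"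
        unfolding b'[OF \<open>\<tau> \<in> T\<close>] sum_distrib_left by (intro sum.cong refl) auto
    qed
    finally show ?thesis .
  qed
  have r_supp: "\<sigma> \<in> D" if "r \<sigma> \<noteq> 0" for \<sigma>
  proof (cases "z \<sigma> = 0")
    case False
    then show ?thesis using z by (simp add: D_def)
  next
    case True
    then have "boundary N y \<sigma> \<noteq> 0" using that by (simp add: r_def)
    then obtain u where u: "u \<in> N - \<sigma>" "insertion_sign u \<sigma> * y (insert u \<sigma>) \<noteq> 0"
      unfolding boundary_def by (rule sum.not_neutral_contains_not_neutral)
    then have "insert u \<sigma> \<in> T" by (auto simp: y_def split: if_splits)
    then show ?thesis using u(1) sub[of "insert u \<sigma>" \<sigma>] fin(1)[of "insert u \<sigma>"] by (auto simp: T_def D_def)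
  qed
  have "\<phi> \<sigma> = 0" if \<sigma>: "\<sigma> \<in> D" for \<sigma>
  proof (rule harmonic_vanishes[OF fW W(2) S g narrow])
    show "\<sigma> \<in> indep_complex W S" "card \<sigma> = K" using \<sigma> by (auto simp: D_def)
  next
    fix \<tau> assume \<tau>: "\<tau> \<in> indep_complex W S" "card \<tau> = Suc K"
    have f: "finite \<tau>" using fin \<tau>(1) by blast
    have inD: "\<tau> - {u} \<in> D" if "u \<in> \<tau>" for u
      using that \<tau> f sub[OF \<tau>(1), of "\<tau> - {u}"] by (auto simp: D_def)
    have "0 = (\<Sum>\<sigma>\<in>D. \<phi> \<sigma> * b \<tau> \<sigma>)"
      using y0 \<tau> by (simp add: T_def \<phi>_def r_def boundary_y)
    also have "\<dots> = (\<Sum>u\<in>\<tau>. \<Sum>\<sigma>\<in>D. if \<sigma> = \<tau> - {u} then \<phi> \<sigma> * insertion_sign u \<sigma> else 0)"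
      unfolding b_def sum_distrib_left by (subst sum.swap) (intro sum.cong refl, auto)
    also have "\<dots> = (\<Sum>u\<in>\<tau>. insertion_sign u (\<tau> - {u}) * \<phi> (\<tau> - {u}))"
      using fTD(2) inD by (intro sum.cong refl) simp
    finally show "(\<Sum>u\<in>\<tau>. insertion_sign u (\<tau> - {u}) * \<phi> (\<tau> - {u})) = 0" by simp
  next
    fix \<rho> assume \<rho>: "\<rho> \<in> indep_complex W S" "Suc (card \<rho>) = K"
    have f: "finite \<rho>" "\<rho> \<subseteq> W" using fin \<rho>(1) by auto
    define G where "G = (\<Prod>v\<in>\<rho>. g v)"
    have G: "G > 0" unfolding G_def using f g by (intro prod_pos) auto
    have lk_notin: "w \<notin> \<rho>" if "w \<in> link W S \<rho>" for w
      using that S(2) by (fastforce simp: link_def)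
    have rw: "r (insert w \<rho>) = G * (g w * \<phi> (insert w \<rho>))" if "w \<in> link W S \<rho>" for w
    proof -
      have "(\<Prod>v\<in>insert w \<rho>. g v) = g w * G" using f lk_notin[OF that] by (simp add: G_def)
      moreover have "g w > 0" using that g by (simp add: link_def)
      ultimately show ?thesis using G by (simp add: \<phi>_def h_def)
    qed
    have "boundary N r \<rho> = boundary N z \<rho> - boundary N (boundary N y) \<rho>"
      unfolding r_def by (simp add: boundary_def right_diff_distrib sum_subtractf)
    then have "0 = boundary N r \<rho>" using cycle boundary_boundary[OF N f(1)] by simp
    also have "\<dots> = (\<Sum>w\<in>link W S \<rho>. insertion_sign w \<rho> * r (insert w \<rho>))"
      unfolding boundary_def
    proof (rule sum.mono_neutral_right)
      show "finite (N - \<rho>)" using N by simp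
      show "link W S \<rho> \<subseteq> N - \<rho>" using lk_notin W(1) by (auto simp: link_def)
      show "\<forall>w\<in>N - \<rho> - link W S \<rho>. insertion_sign w \<rho> * r (insert w \<rho>) = 0"
      proof
        fix w assume w: "w \<in> N - \<rho> - link W S \<rho>"
        have "insert w \<rho> \<notin> indep_complex W S"
          using w by (auto simp: indep_complex_def link_def pairwise_insert)
        then show "insertion_sign w \<rho> * r (insert w \<rho>) = 0" using r_supp[of "insert w \<rho>"] by (auto simp: D_def)
      qed
    qed
    also have "\<dots> = G * (\<Sum>w\<in>link W S \<rho>. g w * (insertion_sign w \<rho> * \<phi> (insert w \<rho>)))"
      unfolding sum_distrib_left by (intro sum.cong refl) (simp add: rw)
    finally show "(\<Sum>w\<in>link W S \<rho>. g w * (insertion_sign w \<rho> * \<phi> (insert w \<rho>))) = 0" using G by simp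
  qed
  then have "r \<sigma> = 0" for \<sigma>
    using r_supp[of \<sigma>] hpos[of \<sigma>] by (fastforce simp: \<phi>_def D_def)
  then have "boundary N y \<sigma> = z \<sigma>" for \<sigma> by (simp add: r_def)
  moreover have "\<sigma> \<in> indep_complex W S \<and> card \<sigma> = Suc K" if "y \<sigma> \<noteq> 0" for \<sigma>
    using that by (auto simp: y_def T_def split: if_splits)
  ultimately show ?thesis by blast
qed

section \<open>Fractional width and disjoint representatives\<close>

lemma fractional_width_le:
  assumes "fractionally_dominating F f"
  shows "fractional_width F \<le> ereal (\<Sum>E\<in>F. f E)"
  unfolding fractional_width_def using assms by (intro INF_lower) simp

text \<open>
  If there were no such weights, \<open>strict_positive_alternative\<close> would give a probability distribution \<open>f\<close> on
  vertices with \<open>K * (\<Sum>u\<in>W. f u * overlap S u w) \<ge> 1\<close> for all \<open>w\<close>. Pushed forward along \<open>S\<close> and scaled by \<open>K\<close>,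
  it is a dominating weight function of total \<open>K\<close>.
\<close>

lemma wide_imp_weights:
  fixes S :: "'v \<Rightarrow> 'a set"
  assumes W: "finite W" and wide: "ereal (real K) < fractional_width (S ` W)"
  shows "W \<noteq> {}"
    and "\<exists>g. (\<forall>w\<in>W. g w > 0) \<and> (\<forall>u\<in>W. real K * (\<Sum>w\<in>W. overlap S u w * g w) < (\<Sum>w\<in>W. g w))"
proof -
  show "W \<noteq> {}"
  proof
    assume "W = {}"
    then have "fractional_width (S ` W) \<le> ereal 0"
      using fractional_width_le[of "{}" "\<lambda>_. 0"] by (simp add: fractionally_dominating_def)
    then have "ereal (real K) < ereal 0" using wide by (rule less_le_trans[rotated])
    then show False by simp
  qed
  have "\<exists>g. (\<forall>w\<in>W. g w > 0) \<and> (\<forall>u\<in>W. (\<Sum>w\<in>W. (real K * overlap S u w - 1) * g w) < 0)"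
  proof (rule strict_positive_alternative[OF W W])
    fix f :: "'v \<Rightarrow> real"
    assume f: "\<forall>u\<in>W. f u \<ge> 0" "(\<Sum>u\<in>W. f u) = 1" "\<forall>w\<in>W. (\<Sum>u\<in>W. f u * (real K * overlap S u w - 1)) \<ge> 0"
    define f' where "f' = (\<lambda>E. real K * (\<Sum>u\<in>{u\<in>W. S u = E}. f u))"
    have push: "(\<Sum>E\<in>S ` W. f' E * c E) = real K * (\<Sum>u\<in>W. f u * c (S u))" for c
    proof -
      have "(\<Sum>u\<in>W. f u * c (S u)) = (\<Sum>E\<in>S ` W. \<Sum>u\<in>{u\<in>W. S u = E}. f u * c (S u))"
        using W by (rule sum.image_gen)
      also have "\<dots> = (\<Sum>E\<in>S ` W. (\<Sum>u\<in>{u\<in>W. S u = E}. f u) * c E)"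
        by (simp add: sum_distrib_right)
      finally show ?thesis by (simp only: f'_def mult.assoc sum_distrib_left[symmetric])
    qed
    have "fractionally_dominating (S ` W) f'"
      unfolding fractionally_dominating_def
    proof (intro conjI ballI)
      fix E show "f' E \<ge> 0" using f(1) by (auto simp: f'_def intro!: mult_nonneg_nonneg sum_nonneg)
    next
      fix E assume "E \<in> S ` W"
      then obtain w where w: "w \<in> W" "E = S w" by blast
      have "0 \<le> (\<Sum>u\<in>W. f u * (real K * overlap S u w - 1))" using f(3) w(1) by blast
      also have "\<dots> = real K * (\<Sum>u\<in>W. f u * overlap S u w) - (\<Sum>u\<in>W. f u)"
        by (simp add: algebra_simps sum_subtractf sum_distrib_left)
      also have "real K * (\<Sum>u\<in>W. f u * overlap S u w) = (\<Sum>G\<in>S ` W. f' G * real (card (E \<inter> G)))"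
        unfolding w(2) Int_commute[of "S w"] by (rule push[symmetric])
      finally show "1 \<le> (\<Sum>G\<in>S ` W. f' G * real (card (E \<inter> G)))" using f(2) by simp
    qed
    then have "fractional_width (S ` W) \<le> ereal (\<Sum>E\<in>S ` W. f' E)" by (rule fractional_width_le)
    also have "(\<Sum>E\<in>S ` W. f' E) = real K" using push[of "\<lambda>_. 1"] f(2) by simp
    finally show False using wide by simp
  qed
  then show "\<exists>g. (\<forall>w\<in>W. g w > 0) \<and> (\<forall>u\<in>W. real K * (\<Sum>w\<in>W. overlap S u w * g w) < (\<Sum>w\<in>W. g w))"
    by (simp add: algebra_simps sum_subtractf sum_distrib_left)
qed

lemma disjoint_rainbow_set:
  fixes S :: "'v::linorder \<Rightarrow> 'a set" and col :: "'v \<Rightarrow> 'c::linorder"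
  assumes N: "finite N" and mono: "mono_on N col" and M: "finite M"
    and S: "\<And>u. u \<in> N \<Longrightarrow> finite (S u)" "\<And>u. u \<in> N \<Longrightarrow> S u \<noteq> {}"
    and wide: "\<And>I. \<lbrakk>I \<subseteq> M; I \<noteq> {}\<rbrakk> \<Longrightarrow>
        ereal (real (card I) - 1) < fractional_width (S ` {v\<in>N. col v \<in> I})"
  shows "\<exists>\<sigma>\<subseteq>N. pairwise (\<lambda>u v. S u \<inter> S v = {}) \<sigma> \<and> inj_on col \<sigma> \<and> col ` \<sigma> = M"
proof -
  have "rainbow (indep_complex N S) col M \<noteq> {}"
  proof (rule homological_Hall[OF N mono M])
    show "{} \<in> indep_complex N S" by (simp add: indep_complex_def)
    show "\<sigma> \<subseteq> N" if "\<sigma> \<in> indep_complex N S" for \<sigma> using that by (simp add: indep_complex_def)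
    show "\<tau> \<in> indep_complex N S" if "\<sigma> \<in> indep_complex N S" "\<tau> \<subseteq> \<sigma>" for \<sigma> \<tau>
      using that by (auto simp: indep_complex_def intro: pairwise_subset)
  next
    fix I z
    assume I: "I \<subseteq> M" "I \<noteq> {}"
      and z: "\<And>\<sigma>. z \<sigma> \<noteq> 0 \<Longrightarrow> \<sigma> \<in> indep_complex N S \<and> col ` \<sigma> \<subseteq> I \<and> card \<sigma> = card I - 1"
      and cycle: "\<And>\<rho>. boundary N z \<rho> = 0"
    define W where "W = {v\<in>N. col v \<in> I}"
    have cI: "card I > 0" using I M finite_subset card_gt_0_iff by blast
    have W: "finite W" "W \<subseteq> N" using N by (auto simp: W_def)
    have iff: "\<sigma> \<in> indep_complex N S \<and> col ` \<sigma> \<subseteq> I \<longleftrightarrow> \<sigma> \<in> indep_complex W S" for \<sigma>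
      by (auto simp: indep_complex_def W_def)
    have "ereal (real (card I - 1)) < fractional_width (S ` W)"
      using wide[OF I] cI by (simp add: W_def of_nat_diff)
    note weights = wide_imp_weights[OF W(1) this]
    from weights(2) obtain g where g: "\<And>w. w \<in> W \<Longrightarrow> g w > 0"
      "\<And>u. u \<in> W \<Longrightarrow> real (card I - 1) * (\<Sum>w\<in>W. overlap S u w * g w) < (\<Sum>w\<in>W. g w)" by blast
    have "\<exists>y. (\<forall>\<sigma>. y \<sigma> \<noteq> 0 \<longrightarrow> \<sigma> \<in> indep_complex W S \<and> card \<sigma> = Suc (card I - 1)) \<and> (\<forall>\<sigma>. boundary N y \<sigma> = z \<sigma>)"
    proof (rule cycle_is_boundary[OF N W(2) weights(1) _ _ g _ cycle])
      show "finite (S u)" "S u \<noteq> {}" if "u \<in> W" for u using S W(2) that by auto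
      show "\<sigma> \<in> indep_complex W S \<and> card \<sigma> = card I - 1" if "z \<sigma> \<noteq> 0" for \<sigma>
        using z[OF that] iff by blast
    qed
    then show "\<exists>y. (\<forall>\<sigma>. y \<sigma> \<noteq> 0 \<longrightarrow> \<sigma> \<in> indep_complex N S \<and> col ` \<sigma> \<subseteq> I \<and> card \<sigma> = card I) \<and> (\<forall>\<sigma>. boundary N y \<sigma> = z \<sigma>)"
      using cI iff by (metis Suc_diff_1)
  qed
  then show ?thesis by (auto simp: rainbow_def indep_complex_def)
qed

theorem theorem1p5:
  fixes V :: "'a set" and m :: nat and F :: "nat \<Rightarrow> 'a set set"
  assumes "finite V"
    and "\<And>i. i \<in> {1..m} \<Longrightarrow> F i \<subseteq> Pow V"
    and "\<And>I. I \<subseteq> {1..m} \<Longrightarrow> I \<noteq> {} \<Longrightarrow>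
           fractional_width (\<Union>i\<in>I. F i) > ereal (real (card I) - 1)"
  shows "\<exists>R. is_SDR m F R"
proof -
  define J where "J = {i\<in>{1..m}. {} \<notin> F i}"
  define U where "U = (\<Union>i\<in>J. F i)"
  have J: "finite J" "J \<subseteq> {1..m}" by (auto simp: J_def)
  have UV: "U \<subseteq> Pow V" unfolding U_def using assms(2) J(2) by (intro UN_least) blast
  then have "finite U" using assms(1) finite_subset by blast
  then obtain e where e: "bij_betw e {0..<card U} U" using ex_bij_betw_nat_finite by blast
  define B where "B = card U"
  define P where "P = {(i, k). i \<in> J \<and> k < B \<and> e k \<in> F i}"
  \<comment> \<open>The pair of index i and edge number k is coded by \<open>i * B + k\<close>, so that the order on the natural numbers
      is lexicographic and the colouring \<open>v div B\<close> is monotone.\<close>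
  define N where "N = (\<lambda>(i, k). i * B + k) ` P"
  define S where "S = (\<lambda>v. e (v mod B))"
  have "P \<subseteq> J \<times> {..<B}" by (auto simp: P_def)
  then have N: "finite N" using J(1) unfolding N_def by (intro finite_imageI) (auto intro: finite_subset)
  have code: "(i * B + k) div B = i" "S (i * B + k) = e k" if "k < B" for i k
    using that by (auto simp: S_def)
  have NE: "v div B \<in> J \<and> S v \<in> F (v div B)" if "v \<in> N" for v
    using that code by (auto simp: N_def P_def)
  have img: "S ` {v\<in>N. v div B \<in> I} = (\<Union>i\<in>I. F i)" if "I \<subseteq> J" for I
  proof
    show "S ` {v\<in>N. v div B \<in> I} \<subseteq> (\<Union>i\<in>I. F i)" using NE by auto
    show "(\<Union>i\<in>I. F i) \<subseteq> S ` {v\<in>N. v div B \<in> I}"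
    proof
      fix E assume "E \<in> (\<Union>i\<in>I. F i)"
      then obtain i where i: "i \<in> I" "E \<in> F i" by blast
      then have "E \<in> U" using that by (auto simp: U_def)
      then have "E \<in> e ` {0..<B}" using e by (simp add: bij_betw_def B_def)
      then obtain k where k: "k < B" "e k = E" by auto
      then have "(i, k) \<in> P" using i that unfolding P_def by blast
      then have "(\<lambda>(i, k). i * B + k) (i, k) \<in> N" unfolding N_def by (rule imageI)
      then have "i * B + k \<in> {v\<in>N. v div B \<in> I}" using code(1)[OF k(1), of i] i(1) by simp
      then have "S (i * B + k) \<in> S ` {v\<in>N. v div B \<in> I}" by (rule imageI)
      then show "E \<in> S ` {v\<in>N. v div B \<in> I}" by (simp only: code(2)[OF k(1)] k(2))
    qed
  qed
  have "\<exists>\<sigma>\<subseteq>N. pairwise (\<lambda>u v. S u \<inter> S v = {}) \<sigma> \<and> inj_on (\<lambda>v. v div B) \<sigma> \<and> (\<lambda>v. v div B) ` \<sigma> = J"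
  proof (rule disjoint_rainbow_set[OF N _ J(1)])
    show "mono_on N (\<lambda>v. v div B)" by (auto intro!: mono_onI div_le_mono)
    fix v assume v: "v \<in> N"
    show "finite (S v)" using NE[OF v] UV assms(1) by (auto simp: U_def intro: finite_subset)
    show "S v \<noteq> {}" using NE[OF v] by (auto simp: J_def)
  next
    fix I assume "I \<subseteq> J" "I \<noteq> {}"
    then show "ereal (real (card I) - 1) < fractional_width (S ` {v\<in>N. v div B \<in> I})"
      using assms(3)[of I] J(2) img by auto
  qed
  then obtain \<sigma> where \<sigma>: "\<sigma> \<subseteq> N" "pairwise (\<lambda>u v. S u \<inter> S v = {}) \<sigma>" "(\<lambda>v. v div B) ` \<sigma> = J" by blast
  define c where "c = inv_into \<sigma> (\<lambda>v. v div B)"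
  have c: "c i \<in> \<sigma>" "c i div B = i" if "i \<in> J" for i
    using that \<sigma>(3) unfolding c_def by (auto intro: inv_into_into f_inv_into_f)
  \<comment> \<open>Outside J the empty edge is available and disjoint from everything.\<close>
  define R where "R = (\<lambda>i. if i \<in> J then S (c i) else {})"
  have "R i \<in> F i" if "i \<in> {1..m}" for i
  proof (cases "i \<in> J")
    case True
    then show ?thesis using c[OF True] NE[of "c i"] \<sigma>(1) by (auto simp: R_def)
  next
    case False
    then show ?thesis using that by (simp add: R_def J_def)
  qed
  moreover have "R i \<inter> R j = {}" if "i \<noteq> j" for i j
  proof (cases "i \<in> J \<and> j \<in> J")
    case True
    then have "c i \<noteq> c j" using c that by metis
    then show ?thesis using True c \<sigma>(2) by (simp add: R_def pairwise_def)
  qed (auto simp: R_def)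
  ultimately show ?thesis unfolding is_SDR_def disjoint_family_on_def by blast
qed

end
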